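(* There exists a universal constant $c>0$ such that for every integer $n\ge 2$, with $K_1=[-1,1]^n$ and $K_2=B^n=\{x\in\mathbb{R}^n:|x|\le 1\}$, $$ d_{PC}(K_1,K_2)\ge c\sqrt{\log n}. $$
   Context: $|\cdot|$ is the Euclidean norm and $\mathrm{Vol}_n$ is $n$-dimensional Lebesgue measure. A convex body is a compact convex set with non-empty interior. The partial containment distance $d_{PC}(K_1,K_2)$ between two convex bodies $K_1,K_2\subseteq\mathbb{R}^n$ is the infimum over all $\lambda\ge 1$ for which there exist an invertible linear map $T:\mathbb{R}^n\to\mathbb{R}^n$ and vectors $x,y\in\mathbb{R}^n$ such that $\tilde K_2=y+K_2$ and $\tilde K_1=T(x+K_1)$ satisfy $$ \mathrm{Vol}_n(\sqrt{\lambda}\,\tilde K_2\cap\tilde K_1)\ge\frac{99}{100}\mathrm{Vol}_n(\tilde K_1)\quad\text{and}\quad \mathrm{Vol}_n(\sqrt{\lambda}\,\tilde K_1\cap\tilde K_2)\ge\frac{99}{100}\mathrm{Vol}_n(\tilde K_2). $$ *)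

theory Defs
  imports "HOL-Analysis.Analysis" "Jordan_Normal_Form.Matrix"
begin

text \<open>
  The space \<open>\<real>\<^sup>n\<close> is rendered as \<open>carrier_vec n :: real vec set\<close>, so that \<open>n\<close> is a
  term and can be quantified after the universal constant. With \<open>n\<close> encoded as a type
  (\<open>real ^ 'n\<close>), a constant that is existentially quantified inside the statement
  could depend on \<open>'n\<close>.
\<close>

type_synonym rvec = "real Matrix.vec"

definition euclidean_norm :: "rvec \<Rightarrow> real" where
  "euclidean_norm x = sqrt (\<Sum>i<dim_vec x. (vec_index x i)\<^sup>2)"

text \<open>
  \<open>Matrix.vec n\<close> is injective on the extensional functions on \<open>{..<n}\<close>, with image
  \<open>carrier_vec n\<close>; hence the embedded measure is the product Borel measure on
  \<open>carrier_vec n\<close>, and its completion is Lebesgue measure.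
\<close>

definition lebesgue_vec :: "nat \<Rightarrow> rvec measure" where
  "lebesgue_vec n = completion (embed_measure (Pi\<^sub>M {..<n} (\<lambda>_. lborel)) (Matrix.vec n))"

abbreviation Vol :: "nat \<Rightarrow> rvec set \<Rightarrow> real" where
  "Vol n \<equiv> measure (lebesgue_vec n)"

definition scale_set :: "real \<Rightarrow> rvec set \<Rightarrow> rvec set" where
  "scale_set a K = (\<lambda>v. a \<cdot>\<^sub>v v) ` K"

definition translate_set :: "rvec \<Rightarrow> rvec set \<Rightarrow> rvec set" where
  "translate_set x K = (\<lambda>v. x + v) ` K"

definition linear_image :: "real mat \<Rightarrow> rvec set \<Rightarrow> rvec set" where
  "linear_image T K = (\<lambda>v. T *\<^sub>v v) ` K"

definition partially_contained :: "nat \<Rightarrow> real \<Rightarrow> rvec set \<Rightarrow> rvec set \<Rightarrow> bool" where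
  "partially_contained n l K L \<longleftrightarrow>
     Vol n (scale_set (sqrt l) L \<inter> K) \<ge> 99 / 100 * Vol n K"

text \<open>
  Intended for convex bodies \<open>K1 K2 \<subseteq> carrier_vec n\<close> with \<open>n \<ge> 1\<close>. For these some
  \<open>l\<close> is always admissible, so the infimum is over a nonempty set of reals bounded
  below by \<open>1\<close>. An invertible linear map is given by its invertible matrix \<open>T\<close>.
\<close>

definition d_PC :: "nat \<Rightarrow> rvec set \<Rightarrow> rvec set \<Rightarrow> real" where
  "d_PC n K1 K2 = Inf {l. l \<ge> 1 \<and>
     (\<exists>T \<in> carrier_mat n n. \<exists>x \<in> carrier_vec n. \<exists>y \<in> carrier_vec n.
        invertible_mat T \<and>
        (let K2' = translate_set y K2;
             K1' = linear_image T (translate_set x K1)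
         in partially_contained n l K1' K2' \<and> partially_contained n l K2' K1'))}"

definition cube :: "nat \<Rightarrow> rvec set" where
  "cube n = {x \<in> carrier_vec n. \<forall>i<n. vec_index x i \<in> {-1..1}}"

definition unit_ball :: "nat \<Rightarrow> rvec set" where
  "unit_ball n = {x \<in> carrier_vec n. euclidean_norm x \<le> 1}"

end

theory Submission
  imports Defs "HOL-Probability.Distributions" "HOL-Real_Asymp.Real_Asymp"
begin

text \<open>
  Write \<open>S = T\<^sup>-\<^sup>1\<close> and let \<open>t\<^sub>i\<close> be the columns of \<open>T\<close>. Intersecting each of the two sets of 99 percent
  measure with its reflection removes the translations: \<open>|T q|\<^sup>2 \<le> \<lambda>\<close> for 98 percent of \<open>q\<close> in the cube,
  and \<open>|(S u)\<^sub>i| \<le> \<surd>\<lambda>\<close> for all \<open>i\<close>, for 98 percent of \<open>u\<close> in the ball. By the comparison of the second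
  and fourth moments of \<open>|T q|\<close>, the first fact gives \<open>\<Sum>|t\<^sub>i|\<^sup>2 \<le> 4 \<lambda>\<close>, so at least half of the columns
  satisfy \<open>|t\<^sub>i|\<^sup>2 \<le> 8 \<lambda> / n\<close>. The Gaussian measure of a parallelepiped with edges \<open>t\<^sub>i\<close> is at most that
  of the rectangular box with the same edge lengths (integrate one edge at a time and project the others
  onto its orthogonal complement). With variance \<open>1/n\<close> each short edge contributes a factor at most
  \<open>1 - exp (- 8 \<lambda>\<^sup>2) / 4\<close>. Since \<open>1 \<le> exp (n/2 (1 - |u|\<^sup>2))\<close> on the ball, passing from the Gaussian to the
  ball costs only a factor linear in \<open>n\<close>, so \<open>\<lambda> < \<surd>(ln n) / 4\<close> is impossible for large \<open>n\<close>.
\<close>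

section \<open>Gaussian integrals over parallelepipeds\<close>


lemma nn_integral_exp_square:
  fixes b :: real
  assumes "b > 0"
  shows "(\<integral>\<^sup>+x. ennreal (exp (- b * x\<^sup>2)) \<partial>lborel) = ennreal (sqrt (pi / b))"
    and "(\<integral>\<^sup>+x. ennreal (exp (- b * x\<^sup>2)) * indicator {0..} x \<partial>lborel) = ennreal (sqrt (pi / b) / 2)"
proof -
  have "(\<integral>\<^sup>+x. ennreal (indicator {0..} x *\<^sub>R exp (- x\<^sup>2)) \<partial>lborel) = ennreal (sqrt pi / 2)"
    using gaussian_moment_0 unfolding has_bochner_integral_iff
    by (subst nn_integral_eq_integral) auto
  then have half: "(\<integral>\<^sup>+x. ennreal (exp (- x\<^sup>2)) * indicator {0..} x \<partial>lborel) = ennreal (sqrt pi / 2)"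
    by (simp add: ennreal_mult' ennreal_indicator mult.commute)
  have "has_bochner_integral lborel (\<lambda>x::real. exp (- x\<^sup>2)) (2 *\<^sub>R (sqrt pi / 2))"
    by (rule has_bochner_integral_even_function[OF gaussian_moment_0]) auto
  then have whole: "(\<integral>\<^sup>+x. ennreal (exp (- x\<^sup>2)) \<partial>lborel) = ennreal (sqrt pi)"
    unfolding has_bochner_integral_iff by (subst nn_integral_eq_integral) auto
  have sq: "b * (x / sqrt b)\<^sup>2 = x\<^sup>2" for x
    using assms by (simp add: power_divide)
  have "(\<integral>\<^sup>+x. ennreal (exp (- b * x\<^sup>2)) \<partial>lborel)
      = ennreal (1 / sqrt b) * (\<integral>\<^sup>+x. ennreal (exp (- x\<^sup>2)) \<partial>lborel)"
    using assms by (subst nn_integral_real_affine[where c = "1 / sqrt b" and t = 0]) (simp_all add: sq)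
  then show "(\<integral>\<^sup>+x. ennreal (exp (- b * x\<^sup>2)) \<partial>lborel) = ennreal (sqrt (pi / b))"
    using assms by (simp add: whole real_sqrt_divide flip: ennreal_mult')
  have ind: "indicator {0..} (x / sqrt b) = (indicator {0..} x :: ennreal)" for x
    using assms by (simp add: indicator_def zero_le_divide_iff)
  have "(\<integral>\<^sup>+x. ennreal (exp (- b * x\<^sup>2)) * indicator {0..} x \<partial>lborel)
      = ennreal (1 / sqrt b) * (\<integral>\<^sup>+x. ennreal (exp (- x\<^sup>2)) * indicator {0..} x \<partial>lborel)"
    using assms by (subst nn_integral_real_affine[where c = "1 / sqrt b" and t = 0]) (simp_all add: sq ind)
  then show "(\<integral>\<^sup>+x. ennreal (exp (- b * x\<^sup>2)) * indicator {0..} x \<partial>lborel) = ennreal (sqrt (pi / b) / 2)"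
    using assms by (simp add: half real_sqrt_divide flip: ennreal_mult')
qed

text \<open>The mass missed by the interval is bounded below uniformly in the centre
  \<open>-m\<close>: the half-line that starts at distance \<open>\<tau>\<close> from the centre, on
  the side away from 0, lies outside the open interval. Since
  \<open>(x + \<tau>)^2 <= 2 * \<tau>^2 + 2 * x^2\<close>, its mass is at least
  \<open>exp (- 2 * b * \<tau>^2)\<close> times that of a centred half-line with parameter
  \<open>2 * b\<close>. Uniformity in \<open>m\<close> is what allows this to be applied inside a
  multiple integral, where the centre depends on the other coordinates.\<close>

lemma nn_integral_gaussian_interval_le:
  fixes b m \<tau> :: real
  assumes "b \<ge> 0" "\<tau> \<ge> 0"
  shows "(\<integral>\<^sup>+x. indicator {-\<tau>..\<tau>} x * ennreal (exp (- b * (x + m)\<^sup>2)) \<partial>lborel)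
     \<le> ennreal (1 - exp (- 2 * b * \<tau>\<^sup>2) / 4) * (\<integral>\<^sup>+x. ennreal (exp (- b * (x + m)\<^sup>2)) \<partial>lborel)"
proof (cases "b = 0")
  \<comment> \<open>For \<open>b = 0\<close> the integral on the right is infinite and its factor is
    3/4. This degenerate case occurs when an edge of the parallelepiped becomes zero after
    projection.\<close>
  case True
  then show ?thesis by (simp add: ennreal_mult_eq_top_iff ennreal_mult_top)
next
  case False
  with assms have b: "b > 0" by simp
  define F where "F = sqrt (pi / b)"
  define d where "d = exp (- 2 * b * \<tau>\<^sup>2) / 4"
  have F: "F > 0" using b by (simp add: F_def)
  have "exp (- 2 * b * \<tau>\<^sup>2) \<le> 1" using b by simp
  then have d: "0 \<le> d" "d \<le> 1" unfolding d_def by (simp, linarith)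
  have total: "(\<integral>\<^sup>+x. ennreal (exp (- b * (x + m)\<^sup>2)) \<partial>lborel) = ennreal F"
    unfolding F_def nn_integral_exp_square(1)[OF b, symmetric]
    by (subst (2) nn_integral_real_affine[where c = 1 and t = m]) (auto simp: add.commute)
  let ?g = "\<lambda>x. ennreal (exp (- b * (x + m)\<^sup>2))"
  let ?tail = "\<integral>\<^sup>+x. ennreal (exp (- b * (x + \<tau>)\<^sup>2)) * indicator {0..} x \<partial>lborel"
  \<comment> \<open>The 4 in \<open>d\<close> comes from here: half the mass for parameter
    \<open>2 * b\<close> is \<open>F / (2 * sqrt 2)\<close>, which is at least
    \<open>F / 4\<close>.\<close>
  have "ennreal (d * F) \<le> ennreal (exp (- 2 * b * \<tau>\<^sup>2)) * ennreal (sqrt (pi / (2 * b)) / 2)"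
  proof -
    have "sqrt 2 \<le> 2" by (rule real_le_lsqrt) auto
    then have "sqrt (pi / b) / 2 \<le> sqrt (pi / b) / sqrt 2"
      using b by (intro divide_left_mono) auto
    also have "\<dots> = sqrt (pi / (2 * b))" by (simp add: real_sqrt_divide real_sqrt_mult)
    finally have *: "F / 4 \<le> sqrt (pi / (2 * b)) / 2" by (simp add: F_def)
    have "d * F = exp (- 2 * b * \<tau>\<^sup>2) * (F / 4)" by (simp add: d_def)
    also have "\<dots> \<le> exp (- 2 * b * \<tau>\<^sup>2) * (sqrt (pi / (2 * b)) / 2)"
      by (rule mult_left_mono[OF *]) simp
    finally show ?thesis by (simp add: ennreal_leI flip: ennreal_mult')
  qed
  also have "\<dots> = (\<integral>\<^sup>+x. ennreal (exp (- 2 * b * \<tau>\<^sup>2)) * (ennreal (exp (- (2*b) * x\<^sup>2)) * indicator {0..} x) \<partial>lborel)"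
    using b nn_integral_exp_square(2)[of "2*b"] by (subst nn_integral_cmult) auto
  also have "\<dots> \<le> ?tail"
  proof (intro nn_integral_mono)
    fix x :: real
    have "(x + \<tau>)\<^sup>2 \<le> 2 * \<tau>\<^sup>2 + 2 * x\<^sup>2" by (smt (verit) sum_squares_bound power2_sum)
    then have "b * (x + \<tau>)\<^sup>2 \<le> b * (2 * \<tau>\<^sup>2 + 2 * x\<^sup>2)" using b by (intro mult_left_mono) auto
    then have "exp (- 2 * b * \<tau>\<^sup>2) * exp (- (2*b) * x\<^sup>2) \<le> exp (- b * (x + \<tau>)\<^sup>2)"
      by (simp add: algebra_simps flip: exp_add)
    then show "ennreal (exp (- 2 * b * \<tau>\<^sup>2)) * (ennreal (exp (- (2*b) * x\<^sup>2)) * indicator {0..} x)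
       \<le> ennreal (exp (- b * (x + \<tau>)\<^sup>2)) * indicator {0..} x"
      by (cases "x \<ge> 0") (simp_all add: ennreal_leI flip: ennreal_mult')
  qed
  \<comment> \<open>depending on the sign of \<open>m\<close>, one of the two half-lines outside the interval has at least the mass of the centred tail\<close>
  also have "\<dots> \<le> (\<integral>\<^sup>+x. indicator (- {-\<tau><..<\<tau>}) x * ?g x \<partial>lborel)"
  proof (cases "m \<le> 0")
    case True
    have "?tail \<le> (\<integral>\<^sup>+x. indicator (- {-\<tau><..<\<tau>}) (x + (\<tau> - m)) * ?g (x + (\<tau> - m)) \<partial>lborel)"
      using True assms by (intro nn_integral_mono) (auto simp: indicator_def)
    also have "\<dots> = (\<integral>\<^sup>+x. indicator (- {-\<tau><..<\<tau>}) x * ?g x \<partial>lborel)"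
      by (subst (2) nn_integral_real_affine[where c = 1 and t = "\<tau> - m"]) (auto simp: add.commute)
    finally show ?thesis .
  next
    case False
    have "?tail \<le> (\<integral>\<^sup>+x. indicator (- {-\<tau><..<\<tau>}) (- \<tau> - m + -1 * x) * ?g (- \<tau> - m + -1 * x) \<partial>lborel)"
    proof (intro nn_integral_mono)
      fix x :: real
      have "(- \<tau> - m + -1 * x + m)\<^sup>2 = (x + \<tau>)\<^sup>2" by (simp add: power2_eq_square algebra_simps)
      then show "ennreal (exp (- b * (x + \<tau>)\<^sup>2)) * indicator {0..} x \<le>
        indicator (- {-\<tau><..<\<tau>}) (- \<tau> - m + -1 * x) * ?g (- \<tau> - m + -1 * x)"
        using False assms by (auto simp: indicator_def)
    qed
    also have "\<dots> = (\<integral>\<^sup>+x. indicator (- {-\<tau><..<\<tau>}) x * ?g x \<partial>lborel)"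
      by (subst (2) nn_integral_real_affine[where c = "-1" and t = "- \<tau> - m"]) auto
    finally show ?thesis .
  qed
  \<comment> \<open>For \<open>m = 0\<close> the half-line contains an endpoint of the interval, so
    the open interval was used first; the two endpoints form a null set.\<close>
  also have "\<dots> = (\<integral>\<^sup>+x. indicator (- {-\<tau>..\<tau>}) x * ?g x \<partial>lborel)"
  proof (intro nn_integral_cong_AE AE_I')
    show "{\<tau>, -\<tau>} \<in> null_sets lborel" by (intro finite_imp_null_set_lborel) auto
  qed (auto simp: indicator_def)
  finally have out: "ennreal (d * F) \<le> (\<integral>\<^sup>+x. indicator (- {-\<tau>..\<tau>}) x * ?g x \<partial>lborel)" (is "_ \<le> ?out") .
  let ?in = "\<integral>\<^sup>+x. indicator {-\<tau>..\<tau>} x * ?g x \<partial>lborel"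
  have "?in + ?out = ennreal F"
    unfolding total[symmetric]
    by (subst nn_integral_add[symmetric]) (auto simp: indicator_def intro!: nn_integral_cong)
  then have "ennreal (d * F) + ?in \<le> ennreal F"
    using add_right_mono[OF out, of ?in] by (simp only: add.commute)
  also have "ennreal F = ennreal (d * F) + ennreal ((1 - d) * F)"
    using F by (subst ennreal_plus[symmetric]) (use d in \<open>auto simp: algebra_simps\<close>)
  finally have "?in \<le> ennreal ((1 - d) * F)"
    by (simp only: ennreal_add_left_cancel_le) simp
  moreover have "ennreal ((1 - d) * F) = ennreal (1 - d) * ennreal F"
    using F by (intro ennreal_mult'') simp
  ultimately show ?thesis
    unfolding total d_def by simp
qed


text \<open>Pythagoras: \<open>c\<close> is the coefficient of the projection of \<open>v\<close>
  onto \<open>t\<close>, and \<open>v - c t\<close> is orthogonal to \<open>t\<close>. For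
  \<open>t = 0\<close> the division convention gives \<open>c = 0\<close> and the identity remains
  true.\<close>

lemma sum_power2_line:
  fixes v t :: "'j \<Rightarrow> real"
  assumes "finite J"
  defines "N \<equiv> \<Sum>j\<in>J. (t j)\<^sup>2" and "c \<equiv> (\<Sum>j\<in>J. v j * t j) / (\<Sum>j\<in>J. (t j)\<^sup>2)"
  shows "(\<Sum>j\<in>J. (v j + q * t j)\<^sup>2) = N * (q + c)\<^sup>2 + (\<Sum>j\<in>J. (v j - c * t j)\<^sup>2)"
proof -
  have Nc: "(\<Sum>j\<in>J. v j * t j) = N * c"
  proof (cases "N = 0")
    case True
    then have "\<forall>j\<in>J. t j = 0"
      using assms by (simp add: sum_nonneg_eq_0_iff)
    then show ?thesis using True by simp
  qed (simp add: N_def c_def)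
  have "(\<Sum>j\<in>J. (v j + x * t j)\<^sup>2) = (\<Sum>j\<in>J. (v j)\<^sup>2) + 2 * x * (N * c) + x\<^sup>2 * N" for x
    unfolding Nc[symmetric]
    by (simp add: power2_sum power_mult_distrib sum.distrib N_def sum_distrib_left mult_ac)
  \<comment> \<open>The instance at \<open>-c\<close> expresses the sum of the
    \<open>(v j)^2\<close> through the orthogonal part; substituting it into the instance at
    \<open>q\<close> completes the square.\<close>
  from this[of q] this[of "-c"] show ?thesis
    by (simp add: power2_eq_square algebra_simps)
qed

text \<open>Along the line the Gaussian is a one-dimensional Gaussian in \<open>y\<close> with
  centre \<open>-c\<close>, times a constant coming from the part of \<open>v\<close> orthogonal to
  \<open>t\<close>. Translation removes the centre from the full integral; for the interval, the
  bound that is uniform in the centre applies.\<close>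

lemma nn_integral_exp_line:
  fixes v t :: "'j \<Rightarrow> real"
  assumes "finite J" "a > 0"
  defines "N \<equiv> \<Sum>j\<in>J. (t j)\<^sup>2" and "c \<equiv> (\<Sum>j\<in>J. v j * t j) / (\<Sum>j\<in>J. (t j)\<^sup>2)"
  shows "(\<integral>\<^sup>+y. ennreal (exp (- a * (\<Sum>j\<in>J. (v j + y * t j)\<^sup>2))) \<partial>lborel)
     = (\<integral>\<^sup>+y. ennreal (exp (- (a * N) * y\<^sup>2)) \<partial>lborel) * ennreal (exp (- a * (\<Sum>j\<in>J. (v j - c * t j)\<^sup>2)))"
    (is "?tot = _ * ?R")
    and "\<tau> \<ge> 0 \<Longrightarrow> (\<integral>\<^sup>+y. indicator {-\<tau>..\<tau>} y * ennreal (exp (- a * (\<Sum>j\<in>J. (v j + y * t j)\<^sup>2))) \<partial>lborel)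
     \<le> ennreal (1 - exp (- 2 * (a * N) * \<tau>\<^sup>2) / 4) * (\<integral>\<^sup>+y. ennreal (exp (- a * (\<Sum>j\<in>J. (v j + y * t j)\<^sup>2))) \<partial>lborel)"
proof -
  have "- a * (\<Sum>j\<in>J. (v j + y * t j)\<^sup>2)
      = - (a * N) * (y + c)\<^sup>2 + - a * (\<Sum>j\<in>J. (v j - c * t j)\<^sup>2)" for y
    unfolding sum_power2_line[OF assms(1)] N_def c_def by (simp add: algebra_simps)
  then have e: "ennreal (exp (- a * (\<Sum>j\<in>J. (v j + y * t j)\<^sup>2))) = ennreal (exp (- (a * N) * (y + c)\<^sup>2)) * ?R" for y
    by (simp only: exp_add ennreal_mult'' exp_ge_zero)
  have tot: "?tot = (\<integral>\<^sup>+y. ennreal (exp (- (a * N) * (y + c)\<^sup>2)) \<partial>lborel) * ?R"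
    unfolding e by (rule nn_integral_multc) measurable
  also have "(\<integral>\<^sup>+y. ennreal (exp (- (a * N) * (y + c)\<^sup>2)) \<partial>lborel) = (\<integral>\<^sup>+y. ennreal (exp (- (a * N) * y\<^sup>2)) \<partial>lborel)"
    by (subst (2) nn_integral_real_affine[where c = 1 and t = c]) (auto simp: add.commute)
  finally show "?tot = (\<integral>\<^sup>+y. ennreal (exp (- (a * N) * y\<^sup>2)) \<partial>lborel) * ?R" .
  assume \<tau>: "\<tau> \<ge> 0"
  have "N \<ge> 0" unfolding N_def by (intro sum_nonneg) auto
  then have "a * N \<ge> 0" using assms by simp
  have "(\<integral>\<^sup>+y. indicator {-\<tau>..\<tau>} y * ennreal (exp (- a * (\<Sum>j\<in>J. (v j + y * t j)\<^sup>2))) \<partial>lborel)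
      = (\<integral>\<^sup>+y. indicator {-\<tau>..\<tau>} y * ennreal (exp (- (a * N) * (y + c)\<^sup>2)) \<partial>lborel) * ?R"
    unfolding e mult.assoc[symmetric] by (rule nn_integral_multc) measurable
  also have "\<dots> \<le> ennreal (1 - exp (- 2 * (a * N) * \<tau>\<^sup>2) / 4) *
      (\<integral>\<^sup>+y. ennreal (exp (- (a * N) * (y + c)\<^sup>2)) \<partial>lborel) * ?R"
    by (intro mult_right_mono nn_integral_gaussian_interval_le \<open>a * N \<ge> 0\<close> \<tau>) simp
  also have "\<dots> = ennreal (1 - exp (- 2 * (a * N) * \<tau>\<^sup>2) / 4) * ?tot"
    unfolding tot by (simp only: mult.assoc)
  finally show "(\<integral>\<^sup>+y. indicator {-\<tau>..\<tau>} y * ennreal (exp (- a * (\<Sum>j\<in>J. (v j + y * t j)\<^sup>2))) \<partial>lborel)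
     \<le> ennreal (1 - exp (- 2 * (a * N) * \<tau>\<^sup>2) / 4) * ?tot" .
qed

text \<open>Induction on the edges. Integrating out the coordinate of the edge \<open>t i\<close>
  replaces all other edges by their projections \<open>p k\<close> onto its orthogonal complement.
  Projections are not longer than the original edges, so the length bound survives for
  \<open>H - {i}\<close>, which is why \<open>H\<close> and \<open>t\<close> are generalized. The
  integrals with and without the box produce the same factor \<open>C\<close>, hence no determinant
  has to be computed.\<close>

lemma nn_integral_gaussian_box_le:
  fixes t :: "'i \<Rightarrow> 'j \<Rightarrow> real"
  assumes "finite I" "finite J" "H \<subseteq> I" "a > 0" "\<tau> \<ge> 0"
    and "\<And>k. k \<in> H \<Longrightarrow> (\<Sum>j\<in>J. (t k j)\<^sup>2) \<le> r"
  shows "(\<integral>\<^sup>+q. (\<Prod>i\<in>I. indicator {-\<tau>..\<tau>} (q i)) * ennreal (exp (- a * (\<Sum>j\<in>J. (\<Sum>i\<in>I. q i * t i j)\<^sup>2))) \<partial>Pi\<^sub>M I (\<lambda>_. lborel))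
    \<le> ennreal (1 - exp (- 2 * (a * r) * \<tau>\<^sup>2) / 4) ^ card H *
      (\<integral>\<^sup>+q. ennreal (exp (- a * (\<Sum>j\<in>J. (\<Sum>i\<in>I. q i * t i j)\<^sup>2))) \<partial>Pi\<^sub>M I (\<lambda>_. lborel))"
  using assms(1,3,6)
proof (induction I arbitrary: H t rule: finite_induct)
  case empty
  then show ?case by simp
next
  case (insert i I)
  interpret product_sigma_finite "\<lambda>_::'i. lborel :: real measure" by standard
  let ?\<delta> = "ennreal (1 - exp (- 2 * (a * r) * \<tau>\<^sup>2) / 4)"
  define N where "N = (\<Sum>j\<in>J. (t i j)\<^sup>2)"
  \<comment> \<open>The component of \<open>t k\<close> orthogonal to \<open>t i\<close>; if
    \<open>N = 0\<close>, the quotient is 0 and \<open>p k\<close> is \<open>t k\<close>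
    itself.\<close>
  define p where "p k j = t k j - (\<Sum>l\<in>J. t k l * t i l) / N * t i j" for k j
  define C where "C = (\<integral>\<^sup>+y. ennreal (exp (- (a * N) * y\<^sup>2)) \<partial>lborel)"
  define \<epsilon> where "\<epsilon> = (if i \<in> H then ?\<delta> else 1)"
  have N: "N \<ge> 0" unfolding N_def by (intro sum_nonneg) auto
  let ?v = "\<lambda>x j. \<Sum>k\<in>I. x k * t k j"
  have proj: "?v x j - (\<Sum>j\<in>J. ?v x j * t i j) / (\<Sum>j\<in>J. (t i j)\<^sup>2) * t i j = (\<Sum>k\<in>I. x k * p k j)" for x j
  proof -
    have "(\<Sum>j\<in>J. ?v x j * t i j) = (\<Sum>k\<in>I. x k * (\<Sum>l\<in>J. t k l * t i l))"
      by (simp add: sum_distrib_right sum_distrib_left mult.assoc) (rule sum.swap)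
    then show ?thesis
      by (simp add: p_def N_def algebra_simps sum_subtractf sum_distrib_left sum_distrib_right sum_divide_distrib)
  qed
  have split: "(\<Sum>k\<in>insert i I. (x(i := y)) k * t k j) = ?v x j + y * t i j" for x y j
    using insert.hyps by (subst sum.insert) (auto intro!: sum.cong)
  \<comment> \<open>\<open>C\<close> is infinite when \<open>t i = 0\<close>. Working in
    \<open>ennreal\<close> throughout means that linearly dependent edges need no separate
    treatment.\<close>
  have full: "(\<integral>\<^sup>+q. ennreal (exp (- a * (\<Sum>j\<in>J. (\<Sum>i\<in>insert i I. q i * t i j)\<^sup>2))) \<partial>Pi\<^sub>M (insert i I) (\<lambda>_. lborel))
     = C * (\<integral>\<^sup>+x. ennreal (exp (- a * (\<Sum>j\<in>J. (\<Sum>k\<in>I. x k * p k j)\<^sup>2))) \<partial>Pi\<^sub>M I (\<lambda>_. lborel))"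
    using insert.hyps
    by (subst product_nn_integral_insert, simp, simp, measurable)
       (simp only: split nn_integral_exp_line(1)[OF assms(2,4)] proj C_def N_def, rule nn_integral_cmult, measurable)
  have inner: "(\<integral>\<^sup>+y. indicator {-\<tau>..\<tau>} y * ennreal (exp (- a * (\<Sum>j\<in>J. (?v x j + y * t i j)\<^sup>2))) \<partial>lborel)
     \<le> \<epsilon> * (C * ennreal (exp (- a * (\<Sum>j\<in>J. (\<Sum>k\<in>I. x k * p k j)\<^sup>2))))" for x
  proof -
    have "(\<integral>\<^sup>+y. indicator {-\<tau>..\<tau>} y * ennreal (exp (- a * (\<Sum>j\<in>J. (?v x j + y * t i j)\<^sup>2))) \<partial>lborel)
      \<le> ennreal (1 - exp (- 2 * (a * N) * \<tau>\<^sup>2) / 4) * (C * ennreal (exp (- a * (\<Sum>j\<in>J. (\<Sum>k\<in>I. x k * p k j)\<^sup>2))))"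
      using nn_integral_exp_line[OF assms(2,4), where v = "?v x" and t = "t i", unfolded proj, folded N_def, folded C_def] assms(5) by simp
    \<comment> \<open>A shorter edge captures a smaller fraction of its Gaussian line. Edges in
      \<open>H\<close> thus give the factor for squared length \<open>r\<close>, and the remaining
      ones are estimated by 1.\<close>
    also have "ennreal (1 - exp (- 2 * (a * N) * \<tau>\<^sup>2) / 4) \<le> \<epsilon>"
    proof (cases "i \<in> H")
      case True
      then have "N \<le> r" using insert.prems by (simp add: N_def)
      then have "2 * (a * N) * \<tau>\<^sup>2 \<le> 2 * (a * r) * \<tau>\<^sup>2"
        using assms(4) by (intro mult_right_mono mult_left_mono) auto
      then show ?thesis using True by (auto simp: \<epsilon>_def intro!: ennreal_leI)
    next
      case False
      then show ?thesis by (auto simp: \<epsilon>_def simp flip: ennreal_1 intro!: ennreal_leI)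
    qed
    finally show ?thesis by (simp add: mult_right_mono)
  qed
  have le: "(\<Sum>j\<in>J. (p k j)\<^sup>2) \<le> r" if "k \<in> H - {i}" for k
  proof -
    have "(\<Sum>j\<in>J. (t k j)\<^sup>2) \<ge> (\<Sum>j\<in>J. (p k j)\<^sup>2)"
      \<comment> \<open>At \<open>q = 0\<close> the decomposition reads: squared length of
        \<open>t k\<close> = a nonnegative term + squared length of \<open>p k\<close>.\<close>
      using sum_power2_line[OF assms(2), of "t k" 0 "t i"] N unfolding p_def N_def by simp
    with that insert.prems show ?thesis by force
  qed
  have "(\<integral>\<^sup>+q. (\<Prod>i\<in>insert i I. indicator {-\<tau>..\<tau>} (q i)) * ennreal (exp (- a * (\<Sum>j\<in>J. (\<Sum>i\<in>insert i I. q i * t i j)\<^sup>2))) \<partial>Pi\<^sub>M (insert i I) (\<lambda>_. lborel))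
     = (\<integral>\<^sup>+x. \<integral>\<^sup>+y. (\<Prod>i\<in>I. indicator {-\<tau>..\<tau>} (x i)) * (indicator {-\<tau>..\<tau>} y * ennreal (exp (- a * (\<Sum>j\<in>J. (?v x j + y * t i j)\<^sup>2)))) \<partial>lborel \<partial>Pi\<^sub>M I (\<lambda>_. lborel))"
  proof -
    have "(\<Prod>k\<in>I. indicator {-\<tau>..\<tau>} ((x(i := y)) k)) = (\<Prod>k\<in>I. indicator {-\<tau>..\<tau>} (x k) :: ennreal)" for x y
      using insert.hyps by (intro prod.cong) auto
    then have "(\<Prod>k\<in>insert i I. indicator {-\<tau>..\<tau>} ((x(i := y)) k)) = (\<Prod>k\<in>I. indicator {-\<tau>..\<tau>} (x k)) * (indicator {-\<tau>..\<tau>} y :: ennreal)" for x y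
      using insert.hyps by (subst prod.insert) (auto simp: mult.commute)
    then show ?thesis
      using insert.hyps by (subst product_nn_integral_insert, simp, simp, measurable) (simp only: split mult.assoc)
  qed
  also have "\<dots> = (\<integral>\<^sup>+x. (\<Prod>i\<in>I. indicator {-\<tau>..\<tau>} (x i)) * (\<integral>\<^sup>+y. indicator {-\<tau>..\<tau>} y * ennreal (exp (- a * (\<Sum>j\<in>J. (?v x j + y * t i j)\<^sup>2))) \<partial>lborel) \<partial>Pi\<^sub>M I (\<lambda>_. lborel))"
    by (intro nn_integral_cong nn_integral_cmult) measurable
  also have "\<dots> \<le> (\<integral>\<^sup>+x. (\<Prod>i\<in>I. indicator {-\<tau>..\<tau>} (x i)) * (\<epsilon> * (C * ennreal (exp (- a * (\<Sum>j\<in>J. (\<Sum>k\<in>I. x k * p k j)\<^sup>2))))) \<partial>Pi\<^sub>M I (\<lambda>_. lborel))"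
    by (intro nn_integral_mono mult_left_mono inner) simp
  also have "\<dots> = (\<integral>\<^sup>+x. \<epsilon> * C * ((\<Prod>i\<in>I. indicator {-\<tau>..\<tau>} (x i)) * ennreal (exp (- a * (\<Sum>j\<in>J. (\<Sum>k\<in>I. x k * p k j)\<^sup>2)))) \<partial>Pi\<^sub>M I (\<lambda>_. lborel))"
    by (simp only: mult_ac)
  also have "\<dots> = \<epsilon> * C * (\<integral>\<^sup>+x. (\<Prod>i\<in>I. indicator {-\<tau>..\<tau>} (x i)) * ennreal (exp (- a * (\<Sum>j\<in>J. (\<Sum>k\<in>I. x k * p k j)\<^sup>2))) \<partial>Pi\<^sub>M I (\<lambda>_. lborel))"
    by (rule nn_integral_cmult) measurable
  also have "\<dots> \<le> \<epsilon> * C * (?\<delta> ^ card (H - {i}) * (\<integral>\<^sup>+x. ennreal (exp (- a * (\<Sum>j\<in>J. (\<Sum>k\<in>I. x k * p k j)\<^sup>2))) \<partial>Pi\<^sub>M I (\<lambda>_. lborel)))"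
    using insert.prems by (intro mult_left_mono insert.IH le) auto
  also have "\<dots> = (\<epsilon> * ?\<delta> ^ card (H - {i})) * (C * (\<integral>\<^sup>+x. ennreal (exp (- a * (\<Sum>j\<in>J. (\<Sum>k\<in>I. x k * p k j)\<^sup>2))) \<partial>Pi\<^sub>M I (\<lambda>_. lborel)))"
    by (simp only: mult_ac)
  also have "\<epsilon> * ?\<delta> ^ card (H - {i}) = ?\<delta> ^ card H"
  proof (cases "i \<in> H")
    case True
    have "finite H" using insert.prems(1) insert.hyps by (meson finite_insert finite_subset)
    then show ?thesis using True by (simp only: \<epsilon>_def if_True card.remove power_Suc)
  qed (simp add: \<epsilon>_def)
  finally show ?case unfolding full .
qed


section \<open>Moments over the cube\<close>

lemma nn_integral_symmetric_interval:
  fixes F F' :: "real \<Rightarrow> real"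
  assumes "\<And>y. (F has_real_derivative F' y) (at y)" "\<And>y. F' y \<ge> 0" "F' \<in> borel_measurable borel"
  shows "(\<integral>\<^sup>+y. indicator {-1..1} y * ennreal (F' y) \<partial>lborel) = ennreal (F 1 - F (-1))"
  using nn_integral_FTC_Icc[of F' "-1" 1 F] assms
  by (simp add: mult.commute has_real_derivative_iff_has_vector_derivative[symmetric]
        has_field_derivative_at_within)

text \<open>The quadratic models the squared norm of \<open>v + y t\<close>, with \<open>A\<close>,
  \<open>B\<close>, \<open>C\<close> the products \<open><v,v>\<close>, \<open><v,t>\<close>,
  \<open><t,t>\<close>; odd powers of \<open>y\<close> integrate to 0. The hypothesis on
  \<open>B\<close> is Cauchy-Schwarz. The second bound is deliberately weakened to the shape that
  lets the induction on the fourth moment close.\<close>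

lemma nn_integral_quadratic:
  fixes A B C :: real
  assumes "\<And>y. A + 2 * y * B + y\<^sup>2 * C \<ge> 0"
  shows "(\<integral>\<^sup>+y. indicator {-1..1} y * ennreal (A + 2 * y * B + y\<^sup>2 * C) \<partial>lborel) = ennreal (2 * (A + C / 3))"
    and "B\<^sup>2 \<le> A * C \<Longrightarrow> (\<integral>\<^sup>+y. indicator {-1..1} y * ennreal ((A + 2 * y * B + y\<^sup>2 * C)\<^sup>2) \<partial>lborel)
      \<le> ennreal (2 * (A\<^sup>2 + 2 * A * C + C\<^sup>2 / 3))"
proof -
  show "(\<integral>\<^sup>+y. indicator {-1..1} y * ennreal (A + 2 * y * B + y\<^sup>2 * C) \<partial>lborel) = ennreal (2 * (A + C / 3))"
    using assms
    by (subst nn_integral_symmetric_interval[where F = "\<lambda>y. A * y + y\<^sup>2 * B + y ^ 3 * C / 3"])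
       (auto intro!: derivative_eq_intros simp: power2_eq_square algebra_simps)
  assume B: "B\<^sup>2 \<le> A * C"
  let ?F = "\<lambda>y. A\<^sup>2 * y + 2 * A * B * y\<^sup>2 + (4 * B\<^sup>2 + 2 * A * C) * y ^ 3 / 3 + B * C * y ^ 4 + C\<^sup>2 * y ^ 5 / 5"
  have "(\<integral>\<^sup>+y. indicator {-1..1} y * ennreal ((A + 2 * y * B + y\<^sup>2 * C)\<^sup>2) \<partial>lborel) = ennreal (?F 1 - ?F (-1))"
  proof (rule nn_integral_symmetric_interval)
    show "(?F has_real_derivative (A + 2 * y * B + y\<^sup>2 * C)\<^sup>2) (at y)" for y
      by (auto intro!: derivative_eq_intros simp: power2_eq_square power3_eq_cube power4_eq_xxxx field_simps)
  qed auto
  also have "?F 1 - ?F (-1) = 2 * (A\<^sup>2 + 2 / 3 * A * C + 4 / 3 * B\<^sup>2 + C\<^sup>2 / 5)"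
    by (simp add: field_simps)
  also have "\<dots> \<le> ennreal (2 * (A\<^sup>2 + 2 * A * C + C\<^sup>2 / 3))"
  proof (rule ennreal_leI)
    \<comment> \<open>The letters stand for \<open>A^2\<close>, \<open>A * C\<close>,
      \<open>B^2\<close> and \<open>C^2\<close>; with these treated as atoms the inequality is
      linear.\<close>
    have "2 * (a + 2 / 3 * p + 4 / 3 * b + c / 5) \<le> 2 * (a + 2 * p + c / 3)"
      if "b \<le> p" "0 \<le> c" for a b c p :: real
      using that by (simp add: field_simps)
    from this[OF B zero_le_power2[of C], of "A\<^sup>2"]
    show "2 * (A\<^sup>2 + 2 / 3 * A * C + 4 / 3 * B\<^sup>2 + C\<^sup>2 / 5) \<le> 2 * (A\<^sup>2 + 2 * A * C + C\<^sup>2 / 3)"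
      by (simp only: mult.assoc)
  qed
  finally show "(\<integral>\<^sup>+y. indicator {-1..1} y * ennreal ((A + 2 * y * B + y\<^sup>2 * C)\<^sup>2) \<partial>lborel)
      \<le> ennreal (2 * (A\<^sup>2 + 2 * A * C + C\<^sup>2 / 3))" .
qed

text \<open>\<open>m\<close> is the mean of \<open>X\<close> under the uniform distribution on the
  cube: distinct coordinates are uncorrelated and each has variance 1/3. The comparison of the mean
  of \<open>X^2\<close> with \<open>3 * m^2\<close> is a Khinchine-type inequality, proved by
  integrating out one coordinate at a time.\<close>

lemma nn_integral_box_moments:
  fixes t :: "'i \<Rightarrow> 'j \<Rightarrow> real"
  assumes "finite I" "finite J"
  defines "X \<equiv> \<lambda>I q. \<Sum>j\<in>J. (\<Sum>i\<in>I. q i * t i j)\<^sup>2"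
    and "m \<equiv> \<lambda>I. (\<Sum>i\<in>I. \<Sum>j\<in>J. (t i j)\<^sup>2) / 3"
    and "cb \<equiv> \<lambda>I q. \<Prod>i\<in>I. indicator {-1..1::real} (q i) :: ennreal"
  shows "(\<integral>\<^sup>+q. cb I q \<partial>Pi\<^sub>M I (\<lambda>_. lborel)) = ennreal (2 ^ card I)"
    and "(\<integral>\<^sup>+q. cb I q * ennreal (X I q) \<partial>Pi\<^sub>M I (\<lambda>_. lborel)) = ennreal (2 ^ card I * m I)"
    and "(\<integral>\<^sup>+q. cb I q * ennreal ((X I q)\<^sup>2) \<partial>Pi\<^sub>M I (\<lambda>_. lborel)) \<le> ennreal (2 ^ card I * (3 * (m I)\<^sup>2))"
proof -
  interpret product_sigma_finite "\<lambda>_::'i. lborel :: real measure" by standard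
  have cb_meas [measurable]: "cb I \<in> borel_measurable (Pi\<^sub>M I (\<lambda>_. lborel))" if "finite I" for I
    unfolding cb_def by measurable
  have X_meas [measurable]: "X I \<in> borel_measurable (Pi\<^sub>M I (\<lambda>_. lborel))" for I
    unfolding X_def by measurable
  have X_ge: "X I q \<ge> 0" for I q unfolding X_def by (intro sum_nonneg) auto
  have m_ge: "m I \<ge> 0" for I unfolding m_def by (intro divide_nonneg_nonneg sum_nonneg) auto
  \<comment> \<open>Peeling off one coordinate for a general \<open>g\<close> serves both moments:
    \<open>g\<close> is the embedding into \<open>ennreal\<close> for the first and the square for
    the second.\<close>
  have step: "(\<integral>\<^sup>+q. cb (insert i I) q * g (X (insert i I) q) \<partial>Pi\<^sub>M (insert i I) (\<lambda>_. lborel))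
    = (\<integral>\<^sup>+x. cb I x * (\<integral>\<^sup>+y. indicator {-1..1} y * 
        g (X I x + 2 * y * (\<Sum>j\<in>J. (\<Sum>k\<in>I. x k * t k j) * t i j) + y\<^sup>2 * (\<Sum>j\<in>J. (t i j)\<^sup>2)) \<partial>lborel) \<partial>Pi\<^sub>M I (\<lambda>_. lborel))"
    if "finite I" "i \<notin> I" and [measurable]: "g \<in> borel_measurable borel" for I i g
  proof -
    have "(\<Prod>k\<in>I. indicator {-1..1::real} ((x(i := y)) k)) = (\<Prod>k\<in>I. indicator {-1..1} (x k) :: ennreal)" for x y
      using that by (intro prod.cong) auto
    then have 1: "cb (insert i I) (x(i := y)) = cb I x * indicator {-1..1} y" for x y
      unfolding cb_def using that by (simp del: fun_upd_apply add: fun_upd_same mult.commute)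
    have 2: "(\<Sum>k\<in>insert i I. (x(i := y)) k * t k j) = (\<Sum>k\<in>I. x k * t k j) + y * t i j" for x y j
      using that by (subst sum.insert) (auto intro!: sum.cong)
    have 3: "X (insert i I) (x(i := y)) = X I x + 2 * y * (\<Sum>j\<in>J. (\<Sum>k\<in>I. x k * t k j) * t i j) + y\<^sup>2 * (\<Sum>j\<in>J. (t i j)\<^sup>2)" for x y
      unfolding X_def 2
      by (simp add: power2_sum power_mult_distrib sum.distrib sum_distrib_left[of _ _ J] mult_ac)
    show ?thesis
      using that(1,2)
      by (subst product_nn_integral_insert, simp, simp, measurable)
         (simp only: 1 3 mult.assoc, intro nn_integral_cong nn_integral_cmult, measurable)
  qed
  have CS: "(\<Sum>j\<in>J. (\<Sum>k\<in>I. x k * t k j) * t i j)\<^sup>2 \<le> X I x * (\<Sum>j\<in>J. (t i j)\<^sup>2)" for I x i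
    unfolding X_def by (rule Cauchy_Schwarz_ineq_sum)
  have nonneg: "X I x + 2 * y * (\<Sum>j\<in>J. (\<Sum>k\<in>I. x k * t k j) * t i j) + y\<^sup>2 * (\<Sum>j\<in>J. (t i j)\<^sup>2) \<ge> 0" for I x y i
  proof -
    have "0 \<le> (\<Sum>j\<in>J. ((\<Sum>k\<in>I. x k * t k j) + y * t i j)\<^sup>2)" by (intro sum_nonneg) auto
    also have "\<dots> = X I x + 2 * y * (\<Sum>j\<in>J. (\<Sum>k\<in>I. x k * t k j) * t i j) + y\<^sup>2 * (\<Sum>j\<in>J. (t i j)\<^sup>2)"
      unfolding X_def by (simp add: power2_sum power_mult_distrib sum.distrib sum_distrib_left[of _ _ J] mult_ac)
    finally show ?thesis .
  qed
  have card0: "(\<integral>\<^sup>+q. cb I q \<partial>Pi\<^sub>M I (\<lambda>_. lborel)) = ennreal (2 ^ card I)" if "finite I" for I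
    unfolding cb_def using that
    by (subst product_nn_integral_prod) (simp_all flip: ennreal_power)
  then show "(\<integral>\<^sup>+q. cb I q \<partial>Pi\<^sub>M I (\<lambda>_. lborel)) = ennreal (2 ^ card I)"
    using assms(1) by blast
  have "(\<integral>\<^sup>+q. cb I q * ennreal (X I q) \<partial>Pi\<^sub>M I (\<lambda>_. lborel)) = ennreal (2 ^ card I * m I) \<and>
    (\<integral>\<^sup>+q. cb I q * ennreal ((X I q)\<^sup>2) \<partial>Pi\<^sub>M I (\<lambda>_. lborel)) \<le> ennreal (2 ^ card I * (3 * (m I)\<^sup>2))"
    using assms(1)
  proof (induction I rule: finite_induct)
    case empty
    then show ?case by (simp add: X_def m_def)
  next
    case (insert i I)
    define C where "C = (\<Sum>j\<in>J. (t i j)\<^sup>2)"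
    have C: "C \<ge> 0" unfolding C_def by (intro sum_nonneg) auto
    have m: "m (insert i I) = m I + C / 3"
      using insert.hyps by (simp add: m_def C_def)
    have "(\<integral>\<^sup>+q. cb (insert i I) q * ennreal (X (insert i I) q) \<partial>Pi\<^sub>M (insert i I) (\<lambda>_. lborel))
      = (\<integral>\<^sup>+x. cb I x * ennreal (2 * (X I x + C / 3)) \<partial>Pi\<^sub>M I (\<lambda>_. lborel))"
      by (subst step[OF insert.hyps]) (simp_all add: nn_integral_quadratic(1)[OF nonneg] C_def)
    also have "\<dots> = (\<integral>\<^sup>+x. 2 * (cb I x * ennreal (X I x)) + ennreal (2 * C / 3) * cb I x \<partial>Pi\<^sub>M I (\<lambda>_. lborel))"
      using X_ge C by (intro nn_integral_cong) (simp add: ennreal_mult ring_distribs mult_ac)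
    also have "\<dots> = 2 * ennreal (2 ^ card I * m I) + ennreal (2 * C / 3) * ennreal (2 ^ card I)"
      using insert.IH insert.hyps by (subst nn_integral_add) (simp_all add: nn_integral_cmult card0)
    also have "\<dots> = ennreal (2 ^ card (insert i I) * m (insert i I))"
      using insert.hyps C m_ge[of I] unfolding m
      by (simp add: algebra_simps flip: ennreal_numeral ennreal_mult ennreal_plus)
    finally have 1: "(\<integral>\<^sup>+q. cb (insert i I) q * ennreal (X (insert i I) q) \<partial>Pi\<^sub>M (insert i I) (\<lambda>_. lborel))
      = ennreal (2 ^ card (insert i I) * m (insert i I))" .
    have "(\<integral>\<^sup>+q. cb (insert i I) q * ennreal ((X (insert i I) q)\<^sup>2) \<partial>Pi\<^sub>M (insert i I) (\<lambda>_. lborel))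
      \<le> (\<integral>\<^sup>+x. cb I x * ennreal (2 * ((X I x)\<^sup>2 + 2 * X I x * C + C\<^sup>2 / 3)) \<partial>Pi\<^sub>M I (\<lambda>_. lborel))"
      by (subst step[OF insert.hyps, where g = "\<lambda>x. ennreal (x\<^sup>2)"], measurable, unfold C_def)
         (intro nn_integral_mono mult_left_mono nn_integral_quadratic(2)[OF nonneg CS]; simp)
    also have "\<dots> = (\<integral>\<^sup>+x. 2 * (cb I x * ennreal ((X I x)\<^sup>2)) + (ennreal (4 * C) * (cb I x * ennreal (X I x)) + ennreal (2 * C\<^sup>2 / 3) * cb I x) \<partial>Pi\<^sub>M I (\<lambda>_. lborel))"
      using X_ge C by (intro nn_integral_cong) (simp add: ennreal_mult ring_distribs mult_ac)
    also have "\<dots> = 2 * (\<integral>\<^sup>+x. cb I x * ennreal ((X I x)\<^sup>2) \<partial>Pi\<^sub>M I (\<lambda>_. lborel)) + (ennreal (4 * C) * ennreal (2 ^ card I * m I) + ennreal (2 * C\<^sup>2 / 3) * ennreal (2 ^ card I))"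
      using insert.IH insert.hyps by (simp add: nn_integral_add nn_integral_cmult card0)
    also have "\<dots> \<le> 2 * ennreal (2 ^ card I * (3 * (m I)\<^sup>2)) + (ennreal (4 * C) * ennreal (2 ^ card I * m I) + ennreal (2 * C\<^sup>2 / 3) * ennreal (2 ^ card I))"
      using insert.IH by (intro add_right_mono mult_left_mono) auto
    also have "\<dots> = ennreal (2 ^ card (insert i I) * (3 * (m I)\<^sup>2 + 2 * C * m I + C\<^sup>2 / 3))"
      using insert.hyps C m_ge[of I] 
      by (simp add: algebra_simps flip: ennreal_numeral ennreal_mult ennreal_plus)
    \<comment> \<open>The constant 3 is exactly what makes the induction close, because the cross
      term \<open>2 * C * m\<close> must be absorbed by the square of
      \<open>m + C / 3\<close>.\<close>
    also have "3 * (m I)\<^sup>2 + 2 * C * m I + C\<^sup>2 / 3 = 3 * (m (insert i I))\<^sup>2"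
      unfolding m by (simp add: power2_eq_square algebra_simps)
    finally show ?case using 1 by blast
  qed
  then show "(\<integral>\<^sup>+q. cb I q * ennreal (X I q) \<partial>Pi\<^sub>M I (\<lambda>_. lborel)) = ennreal (2 ^ card I * m I)"
    and "(\<integral>\<^sup>+q. cb I q * ennreal ((X I q)\<^sup>2) \<partial>Pi\<^sub>M I (\<lambda>_. lborel)) \<le> ennreal (2 ^ card I * (3 * (m I)\<^sup>2))"
    by blast+
qed


text \<open>A Paley-Zygmund argument: a random variable whose second moment is at most three times
  its squared mean cannot have almost all its mass far below the mean. Here \<open>X\<close> is at
  most \<open>l\<close> on 98 percent of the cube, and the mean \<open>m\<close> is one third of the
  sum to be bounded.\<close>

lemma sum_power2_le_of_small_ball:
  fixes t :: "'i \<Rightarrow> 'j \<Rightarrow> real" and l :: real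
  assumes "finite I" "finite J"
    and E: "E \<in> sets (Pi\<^sub>M I (\<lambda>_. lborel))" "\<And>q i. q \<in> E \<Longrightarrow> i \<in> I \<Longrightarrow> q i \<in> {-1..1}"
      "emeasure (Pi\<^sub>M I (\<lambda>_. lborel)) E \<ge> ennreal (49 / 50 * 2 ^ card I)"
      "\<And>q. q \<in> E \<Longrightarrow> (\<Sum>j\<in>J. (\<Sum>i\<in>I. q i * t i j)\<^sup>2) \<le> l"
    and "l \<ge> 0"
  shows "(\<Sum>i\<in>I. \<Sum>j\<in>J. (t i j)\<^sup>2) \<le> 4 * l"
proof (cases "(\<Sum>i\<in>I. \<Sum>j\<in>J. (t i j)\<^sup>2) = 0")
  case False
  let ?M = "Pi\<^sub>M I (\<lambda>_. lborel :: real measure)"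
  define X where "X q = (\<Sum>j\<in>J. (\<Sum>i\<in>I. q i * t i j)\<^sup>2)" for q
  define m where "m = (\<Sum>i\<in>I. \<Sum>j\<in>J. (t i j)\<^sup>2) / 3"
  define cb where "cb q = (\<Prod>i\<in>I. indicator {-1..1::real} (q i) :: ennreal)" for q
  have cb_meas [measurable]: "cb \<in> borel_measurable ?M"
    unfolding cb_def using assms(1) by measurable
  have X_meas [measurable]: "X \<in> borel_measurable ?M"
    unfolding X_def by measurable
  note E(1)[measurable]
  have "m \<ge> 0" unfolding m_def by (intro divide_nonneg_nonneg sum_nonneg) auto
  with False have m: "m > 0" by (simp add: m_def)
  have X_ge: "X q \<ge> 0" for q unfolding X_def by (intro sum_nonneg) auto
  note mom = nn_integral_box_moments(1)[OF assms(1,2), folded cb_def]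
    nn_integral_box_moments(2,3)[OF assms(1,2), where t = t, folded X_def m_def cb_def]
  have cb_cases: "cb q = 0 \<or> cb q = 1" for q
  proof (cases "\<forall>i\<in>I. q i \<in> {-1..1}")
    case True
    then have "cb q = 1" unfolding cb_def by (intro prod.neutral) simp
    then show ?thesis ..
  next
    case False
    then have "cb q = 0" unfolding cb_def using assms(1) by (intro prod_zero) (auto simp: indicator_def)
    then show ?thesis ..
  qed
  have cbE: "cb q = 1" if "q \<in> E" for q
    unfolding cb_def using E(2)[OF that] by (intro prod.neutral) simp
  have "ennreal (2 ^ card I * m) + ennreal (6 * m) * ennreal (49 / 50 * 2 ^ card I)
    \<le> (\<integral>\<^sup>+q. cb q * ennreal (X q) \<partial>?M) + ennreal (6 * m) * emeasure ?M E"
    unfolding mom by (intro add_left_mono mult_left_mono E(3)) simp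
  also have "\<dots> = (\<integral>\<^sup>+q. cb q * ennreal (X q) + ennreal (6 * m) * indicator E q \<partial>?M)"
    by (simp add: nn_integral_add nn_integral_cmult)
  \<comment> \<open>Paley--Zygmund via \<open>X \<le> 6 m + X\<^sup>2 / (24 m)\<close> outside \<open>E\<close>, stated without subtraction\<close>
  also have "\<dots> \<le> (\<integral>\<^sup>+q. ennreal (l + 6 * m) * cb q + ennreal (1 / (24 * m)) * (cb q * ennreal ((X q)\<^sup>2)) \<partial>?M)"
  proof (intro nn_integral_mono)
    fix q
    have "0 \<le> (X q - 12 * m)\<^sup>2" by simp
    then have "24 * m * X q \<le> (X q)\<^sup>2 + 144 * m\<^sup>2" by (simp add: power2_diff power_mult_distrib mult_ac)
    then have amgm: "X q \<le> 6 * m + (X q)\<^sup>2 / (24 * m)"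
      using m by (simp add: field_simps power2_eq_square)
    have "ennreal (l + 6 * m + 1 / (24 * m) * (X q)\<^sup>2) = ennreal (l + 6 * m) + ennreal (1 / (24 * m) * (X q)\<^sup>2)"
      using m \<open>l \<ge> 0\<close> by (intro ennreal_plus) auto
    also have "ennreal (1 / (24 * m) * (X q)\<^sup>2) = ennreal (1 / (24 * m)) * ennreal ((X q)\<^sup>2)"
      by (rule ennreal_mult'') simp
    finally have rhs: "ennreal (l + 6 * m + 1 / (24 * m) * (X q)\<^sup>2)
      = ennreal (l + 6 * m) + ennreal (1 / (24 * m)) * ennreal ((X q)\<^sup>2)" .
    show "cb q * ennreal (X q) + ennreal (6 * m) * indicator E q
      \<le> ennreal (l + 6 * m) * cb q + ennreal (1 / (24 * m)) * (cb q * ennreal ((X q)\<^sup>2))"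
    proof (cases "q \<in> E")
      case True
      have "X q + 6 * m \<le> l + 6 * m + 1 / (24 * m) * (X q)\<^sup>2"
      proof -
        have "X q \<le> l" unfolding X_def by (rule E(4)[OF True])
        moreover have "0 \<le> 1 / (24 * m) * (X q)\<^sup>2" using m by simp
        ultimately show ?thesis by linarith
      qed
      then have "ennreal (X q + 6 * m) \<le> ennreal (l + 6 * m + 1 / (24 * m) * (X q)\<^sup>2)"
        by (rule ennreal_leI)
      moreover have "ennreal (X q + 6 * m) = ennreal (X q) + ennreal (6 * m)"
        using m X_ge by (intro ennreal_plus) auto
      ultimately show ?thesis using True cbE[OF True]
        by (simp only: rhs indicator_simps mult_1 mult_1_right)
    next
      case False
      have "X q \<le> l + 6 * m + 1 / (24 * m) * (X q)\<^sup>2"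
        using amgm \<open>l \<ge> 0\<close> by simp
      then have "ennreal (X q) \<le> ennreal (l + 6 * m + 1 / (24 * m) * (X q)\<^sup>2)"
        by (rule ennreal_leI)
      then show ?thesis using False cb_cases[of q]
        by (elim disjE) (simp_all only: rhs indicator_simps mult_1 mult_1_right mult_zero_left mult_zero_right add_0_right zero_le simp_thms)
    qed
  qed
  also have "\<dots> = ennreal (l + 6 * m) * ennreal (2 ^ card I) + ennreal (1 / (24 * m)) * (\<integral>\<^sup>+q. cb q * ennreal ((X q)\<^sup>2) \<partial>?M)"
    by (simp add: nn_integral_add nn_integral_cmult mom(1))
  also have "\<dots> \<le> ennreal (l + 6 * m) * ennreal (2 ^ card I) + ennreal (1 / (24 * m)) * ennreal (2 ^ card I * (3 * m\<^sup>2))"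
    by (intro add_left_mono mult_left_mono mom(3)) simp
  finally have "2 ^ card I * m + 6 * m * (49 / 50 * 2 ^ card I) \<le> (l + 6 * m) * 2 ^ card I + 1 / (24 * m) * (2 ^ card I * (3 * m\<^sup>2))"
    using m \<open>l \<ge> 0\<close>
    by (subst (asm) (1 2 3) ennreal_mult[symmetric]; simp del: ennreal_plus add: ennreal_plus[symmetric])
  then have "2 ^ card I * (m + 6 * m * (49 / 50)) \<le> 2 ^ card I * (l + 6 * m + m / 8)"
    using m by (simp add: field_simps power2_eq_square)
  \<comment> \<open>After division by the volume of the cube the inequality says that
    \<open>0.755 * m\<close> is at most \<open>l\<close>, which leaves enough room for
    \<open>3 * m <= 4 * l\<close>.\<close>
  then have "m + 6 * m * (49 / 50) \<le> l + 6 * m + m / 8" by simp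
  then have "3 * m \<le> 4 * l" using m by simp
  then show ?thesis by (simp add: m_def)
qed (use assms in simp)


section \<open>Linear change of variables\<close>

text \<open>Restriction to \<open>{..<n}\<close> keeps the values in the space of
  \<open>Leb {..<n}\<close>, whose points are extensional functions.\<close>

definition lmap :: "nat \<Rightarrow> (nat \<Rightarrow> nat \<Rightarrow> real) \<Rightarrow> (nat \<Rightarrow> real) \<Rightarrow> nat \<Rightarrow> real" where
  "lmap n A q = (\<lambda>i\<in>{..<n}. \<Sum>k<n. A i k * q k)"

abbreviation Leb :: "'i set \<Rightarrow> ('i \<Rightarrow> real) measure" where
  "Leb I \<equiv> Pi\<^sub>M I (\<lambda>_. lborel)"

lemma lmap_measurable [measurable]: "lmap n A \<in> Leb {..<n} \<rightarrow>\<^sub>M Leb {..<n}"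
  unfolding lmap_def by measurable

lemma lmap_coord_measurable:
  assumes "i < n"
  shows "(\<lambda>q. lmap n A q i) \<in> borel_measurable (Leb {..<n})" "(\<lambda>q. q i) \<in> borel_measurable (Leb {..<n})"
proof -
  show coord: "(\<lambda>q. q i) \<in> borel_measurable (Leb {..<n})"
    using measurable_component_singleton[of i "{..<n}" "\<lambda>_. lborel :: real measure"] assms by simp
  show "(\<lambda>q. lmap n A q i) \<in> borel_measurable (Leb {..<n})"
    by (rule measurable_compose[OF lmap_measurable coord])
qed

lemma distr_lborel_isometry:
  fixes c s :: real
  assumes "\<bar>c\<bar> = 1"
  shows "distr lborel borel (\<lambda>x. s + c * x) = lborel"
  using lborel_real_affine[of c s] assms by (simp add: density_1)

text \<open>Coordinatewise affine maps with factor 1 or -1 cover both the translations and the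
  reflection through the origin. Agreement on boxes suffices, where the claim reduces to one
  dimension.\<close>

lemma distr_Leb_isometry:
  assumes "finite I" "\<bar>c\<bar> = 1"
  shows "distr (Leb I) (Leb I) (\<lambda>x. \<lambda>i\<in>I. s i + c * x i) = Leb I"
proof -
  interpret product_sigma_finite "\<lambda>_::'a. lborel :: real measure" by standard
  show ?thesis
  proof (rule PiM_eqI)
    fix A :: "'a \<Rightarrow> real set" assume A: "\<And>i. i \<in> I \<Longrightarrow> A i \<in> sets lborel"
    let ?f = "\<lambda>x. \<lambda>i\<in>I. s i + c * x i"
    have "emeasure (distr (Leb I) (Leb I) ?f) (Pi\<^sub>E I A) = emeasure (Leb I) (?f -` Pi\<^sub>E I A \<inter> space (Leb I))"
      using A assms by (intro emeasure_distr) (auto intro!: sets_PiM_I_finite)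
    also have "?f -` Pi\<^sub>E I A \<inter> space (Leb I) = Pi\<^sub>E I (\<lambda>i. (\<lambda>x. s i + c * x) -` A i)"
      by (auto simp: space_PiM PiE_def Pi_def extensional_def)
    also have "emeasure (Leb I) \<dots> = (\<Prod>i\<in>I. emeasure lborel ((\<lambda>x. s i + c * x) -` A i))"
      using A assms by (intro emeasure_PiM) (auto intro!: measurable_sets_borel[of _ borel])
    also have "\<dots> = (\<Prod>i\<in>I. emeasure (distr lborel borel (\<lambda>x. s i + c * x)) (A i))"
      using A by (intro prod.cong refl) (subst emeasure_distr, auto)
    also have "\<dots> = (\<Prod>i\<in>I. emeasure lborel (A i))"
      by (simp add: distr_lborel_isometry assms)
    finally show "emeasure (distr (Leb I) (Leb I) ?f) (Pi\<^sub>E I A) = (\<Prod>i\<in>I. emeasure lborel (A i))" .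
  qed (use assms in auto)
qed

lemma nn_integral_Leb_isometry:
  assumes "finite I" "\<bar>c\<bar> = 1" "h \<in> borel_measurable (Leb I)"
  shows "(\<integral>\<^sup>+x. h (\<lambda>i\<in>I. s i + c * x i) \<partial>Leb I) = (\<integral>\<^sup>+x. h x \<partial>Leb I)"
proof -
  have "(\<integral>\<^sup>+x. h x \<partial>Leb I) = (\<integral>\<^sup>+x. h x \<partial>distr (Leb I) (Leb I) (\<lambda>x. \<lambda>i\<in>I. s i + c * x i))"
    by (simp only: distr_Leb_isometry[OF assms(1,2)])
  also have "\<dots> = (\<integral>\<^sup>+x. h (\<lambda>i\<in>I. s i + c * x i) \<partial>Leb I)"
    using assms by (intro nn_integral_distr) auto
  finally show ?thesis ..
qed

lemma nn_integral_gaussian_Leb: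
  assumes "finite I" "a > 0"
  shows "(\<integral>\<^sup>+q. ennreal (exp (- a * (\<Sum>i\<in>I. (q i)\<^sup>2))) \<partial>Leb I) = ennreal (sqrt (pi / a) ^ card I)"
proof -
  interpret product_sigma_finite "\<lambda>_::'a. lborel :: real measure" by standard
  have "(\<integral>\<^sup>+q. ennreal (exp (- a * (\<Sum>i\<in>I. (q i)\<^sup>2))) \<partial>Leb I) = (\<integral>\<^sup>+q. (\<Prod>i\<in>I. ennreal (exp (- a * (q i)\<^sup>2))) \<partial>Leb I)"
    using assms by (simp add: prod_ennreal exp_sum sum_distrib_left flip: sum_negf)
  also have "\<dots> = (\<Prod>i\<in>I. (\<integral>\<^sup>+x. ennreal (exp (- a * x\<^sup>2)) \<partial>lborel))"
    using assms by (intro product_nn_integral_prod) auto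
  also have "\<dots> = ennreal (sqrt (pi / a) ^ card I)"
    unfolding nn_integral_exp_square(1)[OF assms(2)] using assms by (simp add: ennreal_power)
  finally show ?thesis .
qed

locale inverse_matrices =
  fixes n :: nat and S T :: "nat \<Rightarrow> nat \<Rightarrow> real"
  assumes ST: "\<And>i j. i < n \<Longrightarrow> j < n \<Longrightarrow> (\<Sum>k<n. S i k * T k j) = (if i = j then 1 else 0)"
    and TS: "\<And>i j. i < n \<Longrightarrow> j < n \<Longrightarrow> (\<Sum>k<n. T i k * S k j) = (if i = j then 1 else 0)"
begin

lemma lmap_inverse_aux:
  assumes "i < n" "\<And>j. j < n \<Longrightarrow> (\<Sum>k<n. A i k * B k j) = (if i = j then 1 else 0)"
  shows "lmap n A (lmap n B q) i = q i"
proof -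
  have "lmap n A (lmap n B q) i = (\<Sum>k<n. \<Sum>j<n. A i k * B k j * q j)"
    using assms(1) by (simp add: lmap_def sum_distrib_left mult.assoc)
  also have "\<dots> = (\<Sum>j<n. (\<Sum>k<n. A i k * B k j) * q j)"
    by (subst sum.swap) (simp add: sum_distrib_right)
  also have "\<dots> = (\<Sum>j<n. if j = i then q j else 0)"
    using assms by (intro sum.cong) auto
  also have "\<dots> = q i" using assms(1) by simp
  finally show ?thesis .
qed

lemma lmap_S_T: "i < n \<Longrightarrow> lmap n S (lmap n T q) i = q i"
  by (rule lmap_inverse_aux) (auto simp: ST)

lemma lmap_T_S: "i < n \<Longrightarrow> lmap n T (lmap n S q) i = q i"
  by (rule lmap_inverse_aux) (auto simp: TS)

text \<open>
  Fubini for \<open>g (S z) h (S z + y)\<close> together with translation invariance; this yields the Jacobian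
  of \<open>S\<close> without determinants.
\<close>
lemma nn_integral_lmap_commute:
  fixes g h :: "(nat \<Rightarrow> real) \<Rightarrow> ennreal"
  assumes [measurable]: "g \<in> borel_measurable (Leb {..<n})" "h \<in> borel_measurable (Leb {..<n})"
  shows "(\<integral>\<^sup>+z. g (lmap n S z) \<partial>Leb {..<n}) * (\<integral>\<^sup>+y. h y \<partial>Leb {..<n})
       = (\<integral>\<^sup>+z. h (lmap n S z) \<partial>Leb {..<n}) * (\<integral>\<^sup>+y. g y \<partial>Leb {..<n})"
proof -
  interpret product_sigma_finite "\<lambda>_::nat. lborel :: real measure" by standard
  let ?M = "Leb {..<n}"
  interpret sigma_finite_measure ?M by (rule sigma_finite) simp
  interpret pair_sigma_finite ?M ?M ..
  have shift_meas':
    "(\<lambda>z. g (lmap n S z) * h (\<lambda>i\<in>{..<n}. lmap n S z i + 1 * y i)) \<in> borel_measurable ?M" for y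
  proof -
    have "(\<lambda>z. \<lambda>i\<in>{..<n}. lmap n S z i + 1 * y i) \<in> ?M \<rightarrow>\<^sub>M ?M"
      by (rule measurable_restrict) (auto intro!: borel_measurable_add lmap_coord_measurable)
    from measurable_compose[OF this assms(2)] measurable_compose[OF lmap_measurable assms(1)]
    show ?thesis by (rule borel_measurable_times_ennreal[rotated])
  qed
  have shift_meas: "(\<lambda>(z, y). \<lambda>i\<in>{..<n}. lmap n S z i + c * y i) \<in> ?M \<Otimes>\<^sub>M ?M \<rightarrow>\<^sub>M ?M" for c
    unfolding lmap_def case_prod_unfold
  proof (rule measurable_restrict)
    fix i assume i: "i \<in> {..<n}"
    from lmap_coord_measurable(2) have [measurable]: "k < n \<Longrightarrow> (\<lambda>x. fst x k) \<in> borel_measurable (?M \<Otimes>\<^sub>M ?M)"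
      "k < n \<Longrightarrow> (\<lambda>x. snd x k) \<in> borel_measurable (?M \<Otimes>\<^sub>M ?M)" for k
      by (auto intro: measurable_compose[OF measurable_fst] measurable_compose[OF measurable_snd])
    show "(\<lambda>x. (\<lambda>i\<in>{..<n}. \<Sum>k<n. S i k * fst x k) i + c * snd x i) \<in> ?M \<Otimes>\<^sub>M ?M \<rightarrow>\<^sub>M lborel"
      using i by simp
  qed
  have fst_meas: "(\<lambda>(z, y). lmap n S z) \<in> ?M \<Otimes>\<^sub>M ?M \<rightarrow>\<^sub>M ?M"
    unfolding case_prod_unfold by (rule measurable_compose[OF measurable_fst lmap_measurable])
  have prod_meas: "(\<lambda>(z, y). g (lmap n S z) * h (\<lambda>i\<in>{..<n}. lmap n S z i + 1 * y i)) \<in> borel_measurable (?M \<Otimes>\<^sub>M ?M)"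
    "(\<lambda>(z, y). g (\<lambda>i\<in>{..<n}. lmap n S z i + (-1) * y i) * h (lmap n S z)) \<in> borel_measurable (?M \<Otimes>\<^sub>M ?M)"
    using borel_measurable_times_ennreal[OF measurable_compose[OF fst_meas assms(1)] measurable_compose[OF shift_meas[of 1] assms(2)]]
      borel_measurable_times_ennreal[OF measurable_compose[OF shift_meas[of "-1"] assms(1)] measurable_compose[OF fst_meas assms(2)]]
    by (simp_all only: case_prod_unfold)
  have "(\<integral>\<^sup>+z. g (lmap n S z) \<partial>?M) * (\<integral>\<^sup>+y. h y \<partial>?M) = (\<integral>\<^sup>+z. g (lmap n S z) * (\<integral>\<^sup>+y. h y \<partial>?M) \<partial>?M)"
    by (rule nn_integral_multc[symmetric]) measurable
  \<comment> \<open>For fixed \<open>z\<close> the translation by \<open>S z\<close> leaves the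
    integral of \<open>h\<close> unchanged.\<close>
  also have "\<dots> = (\<integral>\<^sup>+z. \<integral>\<^sup>+y. g (lmap n S z) * h (\<lambda>i\<in>{..<n}. lmap n S z i + 1 * y i) \<partial>?M \<partial>?M)"
  proof (intro nn_integral_cong)
    fix z
    have "(\<integral>\<^sup>+y. h y \<partial>?M) = (\<integral>\<^sup>+y. h (\<lambda>i\<in>{..<n}. lmap n S z i + 1 * y i) \<partial>?M)"
      by (rule nn_integral_Leb_isometry[symmetric]) auto
    moreover have "g (lmap n S z) * (\<integral>\<^sup>+y. h (\<lambda>i\<in>{..<n}. lmap n S z i + 1 * y i) \<partial>?M)
        = (\<integral>\<^sup>+y. g (lmap n S z) * h (\<lambda>i\<in>{..<n}. lmap n S z i + 1 * y i) \<partial>?M)"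
      by (rule nn_integral_cmult[symmetric]) measurable
    ultimately show "g (lmap n S z) * (\<integral>\<^sup>+y. h y \<partial>?M)
        = (\<integral>\<^sup>+y. g (lmap n S z) * h (\<lambda>i\<in>{..<n}. lmap n S z i + 1 * y i) \<partial>?M)"
      by (simp only:)
  qed
  also have "\<dots> = (\<integral>\<^sup>+y. \<integral>\<^sup>+z. g (lmap n S z) * h (\<lambda>i\<in>{..<n}. lmap n S z i + 1 * y i) \<partial>?M \<partial>?M)"
    by (rule Fubini'[OF prod_meas(1), symmetric])
  \<comment> \<open>With \<open>y\<close> fixed, \<open>z\<close> is translated by
    \<open>- T y\<close>; since \<open>S (T y) = y\<close>, this turns \<open>S z + y\<close> into
    \<open>S z\<close> and \<open>S z\<close> into \<open>S z - y\<close>.\<close>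
  also have "\<dots> = (\<integral>\<^sup>+y. \<integral>\<^sup>+z. g (\<lambda>i\<in>{..<n}. lmap n S z i + (-1) * y i) * h (lmap n S z) \<partial>?M \<partial>?M)"
  proof (rule nn_integral_cong)
    fix y :: "nat \<Rightarrow> real"
    have *: "lmap n S (\<lambda>i\<in>{..<n}. - lmap n T y i + 1 * z i) = (\<lambda>i\<in>{..<n}. lmap n S z i + (-1) * y i)" for z
    proof
      fix i
      show "lmap n S (\<lambda>i\<in>{..<n}. - lmap n T y i + 1 * z i) i = (\<lambda>i\<in>{..<n}. lmap n S z i + (-1) * y i) i"
      proof (cases "i < n")
        case True
        then have "lmap n S (\<lambda>i\<in>{..<n}. - lmap n T y i + 1 * z i) i = lmap n S z i - lmap n S (lmap n T y) i"
          by (simp add: lmap_def[of n S] algebra_simps sum_subtractf)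
        then show ?thesis using True by (simp add: lmap_S_T)
      qed (simp add: lmap_def)
    qed
    have **: "(\<lambda>i\<in>{..<n}. (\<lambda>i\<in>{..<n}. lmap n S z i + (-1) * y i) i + 1 * y i) = lmap n S z" for z
      by (rule ext) (simp add: lmap_def)
    have "(\<integral>\<^sup>+z. g (lmap n S z) * h (\<lambda>i\<in>{..<n}. lmap n S z i + 1 * y i) \<partial>?M)
      = (\<integral>\<^sup>+z. (\<lambda>z. g (lmap n S z) * h (\<lambda>i\<in>{..<n}. lmap n S z i + 1 * y i)) (\<lambda>i\<in>{..<n}. - lmap n T y i + 1 * z i) \<partial>?M)"
      by (rule nn_integral_Leb_isometry[symmetric]) (use shift_meas' in simp_all)
    then show "(\<integral>\<^sup>+z. g (lmap n S z) * h (\<lambda>i\<in>{..<n}. lmap n S z i + 1 * y i) \<partial>?M)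
      = (\<integral>\<^sup>+z. g (\<lambda>i\<in>{..<n}. lmap n S z i + (-1) * y i) * h (lmap n S z) \<partial>?M)"
      by (simp only: * **)
  qed
  also have "\<dots> = (\<integral>\<^sup>+z. \<integral>\<^sup>+y. g (\<lambda>i\<in>{..<n}. lmap n S z i + (-1) * y i) * h (lmap n S z) \<partial>?M \<partial>?M)"
    by (rule Fubini'[OF prod_meas(2)])
  also have "\<dots> = (\<integral>\<^sup>+z. h (lmap n S z) * (\<integral>\<^sup>+y. g y \<partial>?M) \<partial>?M)"
  proof (intro nn_integral_cong)
    fix z
    have "(\<integral>\<^sup>+y. g (\<lambda>i\<in>{..<n}. lmap n S z i + (-1) * y i) * h (lmap n S z) \<partial>?M)
      = (\<integral>\<^sup>+y. g (\<lambda>i\<in>{..<n}. lmap n S z i + (-1) * y i) \<partial>?M) * h (lmap n S z)"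
      by (rule nn_integral_multc) measurable
    also have "(\<integral>\<^sup>+y. g (\<lambda>i\<in>{..<n}. lmap n S z i + (-1) * y i) \<partial>?M) = (\<integral>\<^sup>+y. g y \<partial>?M)"
      by (rule nn_integral_Leb_isometry) auto
    finally show "(\<integral>\<^sup>+y. g (\<lambda>i\<in>{..<n}. lmap n S z i + (-1) * y i) * h (lmap n S z) \<partial>?M) = h (lmap n S z) * (\<integral>\<^sup>+y. g y \<partial>?M)"
      by (simp only: mult.commute)
  qed
  also have "\<dots> = (\<integral>\<^sup>+z. h (lmap n S z) \<partial>?M) * (\<integral>\<^sup>+y. g y \<partial>?M)"
    by (rule nn_integral_multc) measurable
  finally show ?thesis .
qed

text \<open>Take \<open>h\<close> to be the Gaussian \<open>\<phi>\<close> composed with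
  \<open>T\<close> in the commutation identity. Then \<open>h\<close> composed with \<open>S\<close>
  is \<open>\<phi>\<close> again, whose integral \<open>G\<close> is known, so the identity becomes
  a proportionality with constant \<open>\<kappa> = G / H\<close>.\<close>

lemma ex_jacobian:
  "\<exists>\<kappa>>0. \<forall>g \<in> borel_measurable (Leb {..<n}).
     (\<integral>\<^sup>+z. g (lmap n S z) \<partial>Leb {..<n}) = ennreal \<kappa> * (\<integral>\<^sup>+y. g y \<partial>Leb {..<n})"
proof -
  let ?M = "Leb {..<n}"
  define \<phi> where "\<phi> q = ennreal (exp (- 1 * (\<Sum>i<n. (q i)\<^sup>2)))" for q :: "nat \<Rightarrow> real"
  define G where "G = sqrt (pi / 1) ^ n"
  have G: "G > 0" by (simp add: G_def)
  have \<phi>[measurable]: "\<phi> \<in> borel_measurable ?M" unfolding \<phi>_def by measurable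
  have int\<phi>: "(\<integral>\<^sup>+q. \<phi> q \<partial>?M) = ennreal G"
    unfolding \<phi>_def G_def by (subst nn_integral_gaussian_Leb) simp_all
  define H where "H = (\<integral>\<^sup>+q. \<phi> (lmap n T q) \<partial>?M)"
  have "(\<integral>\<^sup>+z. \<phi> (lmap n T (lmap n S z)) \<partial>?M) = ennreal G"
    unfolding int\<phi>[symmetric] by (intro nn_integral_cong) (simp add: \<phi>_def lmap_T_S)
  then have *: "(\<integral>\<^sup>+z. g (lmap n S z) \<partial>?M) * H = ennreal G * (\<integral>\<^sup>+y. g y \<partial>?M)"
    if "g \<in> borel_measurable ?M" for g :: "(nat \<Rightarrow> real) \<Rightarrow> ennreal"
    using nn_integral_lmap_commute[OF that, of "\<lambda>q. \<phi> (lmap n T q)"] by (simp add: H_def)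
  \<comment> \<open>The test function \<open>g = \<phi>\<close> shows that \<open>H\<close> is
    neither 0 nor infinite, as the product is positive and finite.\<close>
  from *[OF \<phi>] have GG: "(\<integral>\<^sup>+z. \<phi> (lmap n S z) \<partial>?M) * H = ennreal (G * G)"
    using G by (simp add: int\<phi> ennreal_mult)
  have "H \<noteq> 0" using GG G by auto
  moreover have "H \<noteq> \<infinity>"
    using GG G by (auto simp: ennreal_mult_top split: if_splits)
  ultimately obtain r where r: "H = ennreal r" "r > 0"
    by (cases H) (auto simp: top_unique less_le)
  show ?thesis
  proof (intro exI[of _ "G / r"] conjI ballI)
    fix g :: "(nat \<Rightarrow> real) \<Rightarrow> ennreal" assume "g \<in> borel_measurable ?M"
    from *[OF this] have "(\<integral>\<^sup>+z. g (lmap n S z) \<partial>?M) * ennreal r * ennreal (1 / r) = ennreal (1 / r) * ennreal G * (\<integral>\<^sup>+y. g y \<partial>?M)"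
      by (simp add: r mult_ac)
    moreover have "ennreal r * ennreal (1 / r) = 1" "ennreal (1 / r) * ennreal G = ennreal (G / r)"
      using r G by (simp_all flip: ennreal_mult)
    ultimately show "(\<integral>\<^sup>+z. g (lmap n S z) \<partial>?M) = ennreal (G / r) * (\<integral>\<^sup>+y. g y \<partial>?M)"
      by (simp add: mult.assoc)
  qed (use G r in auto)
qed

end


section \<open>Comparison of the Gaussian with the ball\<close>

text \<open>A crude Stirling bound, weaker than the true growth by a factor of order
  \<open>sqrt n\<close>, which is harmless later. The induction goes in steps of two, so
  \<open>n = 1\<close> and \<open>n = 2\<close> are base cases, and the constant 5 is large enough
  for both. With \<open>x = n / 2 - 1\<close> the step reduces to
  \<open>exp 1 * x powr (x + 1) <= (x + 1) powr (x + 1)\<close>, that is, to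
  \<open>ln u <= u - 1\<close> at \<open>u = x / (x + 1)\<close>.\<close>

lemma Gamma_half_nat_le:
  assumes "n \<ge> 1"
  shows "Gamma (real n / 2 + 1) \<le> 5 * (real n / 2) powr (real n / 2 + 1) * exp (- (real n / 2))"
  using assms
proof (induction n rule: less_induct)
  case (less n)
  consider "n = 1" | "n = 2" | "n \<ge> 3" using less.prems by linarith
  then show ?case
  proof cases
    case 1
    have "sqrt pi \<le> 2" using pi_less_4 by (intro real_le_lsqrt) auto
    have e: "exp 1 \<le> (3::real)" by (rule exp_le)
    then have "exp (1/2 :: real) \<le> sqrt 3"
      by (intro real_le_rsqrt) (simp add: power2_eq_square flip: exp_add)
    \<comment> \<open>The exponential is eliminated through \<open>exp 1 <= 3\<close>, so what
      remains for \<open>n = 1\<close> is \<open>sqrt 6 <= 5 / 2\<close>.\<close>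
    have "sqrt 3 * sqrt 2 \<le> 5 / (2::real)"
      unfolding real_sqrt_mult[symmetric] by (intro real_le_lsqrt) (auto simp: power2_eq_square)
    have "exp (1/2) * sqrt 2 \<le> 5 / (2::real)"
      using mult_right_mono[OF \<open>exp (1/2 :: real) \<le> sqrt 3\<close>, of "sqrt 2"] \<open>sqrt 3 * sqrt 2 \<le> 5/2\<close>
      by (meson order_trans real_sqrt_ge_zero zero_le_numeral)
    then have "1 \<le> 5 / 2 * (1 / sqrt 2) * (1 / exp (1/2 :: real))"
      by (simp add: field_simps)
    also have "\<dots> = 5 * (1/2) powr (3/2) * exp (- (1/2 :: real))"
    proof -
      have "(1/2 :: real) powr (3/2) = (1/2) powr 1 * (1/2) powr (1/2)"
        by (subst powr_add[symmetric]) simp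
      also have "\<dots> = 1/2 * (1 / sqrt 2)"
        by (simp add: powr_half_sqrt real_sqrt_divide)
      finally show ?thesis by (simp add: exp_minus inverse_eq_divide)
    qed
    finally have "1 \<le> 5 * (1/2) powr (3/2) * exp (- (1/2 :: real))" .
    moreover have "Gamma (3/2 :: real) \<le> 1"
    proof -
      have "Gamma (1/2 + 1 :: real) = 1/2 * Gamma (1/2)"
        by (rule Gamma_plus1) auto
      then show ?thesis using \<open>sqrt pi \<le> 2\<close> by (simp add: Gamma_one_half_real)
    qed
    ultimately show ?thesis using 1 by (simp add: add.commute)
  next
    case 2
    have "exp 1 \<le> (3::real)" by (rule exp_le)
    then have "1 \<le> 5 * exp (- 1 :: real)" by (simp add: exp_minus field_simps)
    moreover have "Gamma (2 :: real) = 1"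
      using Gamma_fact[of 1, where 'a = real] by simp
    ultimately show ?thesis using 2 by simp
  next
    case 3
    define x where "x = real (n - 2) / 2"
    have x: "x > 0" "real n / 2 = x + 1" using 3 by (auto simp: x_def of_nat_diff field_simps)
    have IH: "Gamma (x + 1) \<le> 5 * x powr (x + 1) * exp (- x)"
      using less.IH[of "n - 2"] 3 unfolding x_def by auto
    have "ln (x / (x + 1)) \<le> x / (x + 1) - 1"
      using x by (intro ln_le_minus_one) auto
    then have "(x + 1) * ln (x / (x + 1)) \<le> -1"
      using x by (simp add: field_simps)
    then have "1 + (x + 1) * ln x \<le> (x + 1) * ln (x + 1)"
      using x by (simp add: ln_div algebra_simps)
    then have "exp 1 * x powr (x + 1) \<le> (x + 1) powr (x + 1)"
      using x by (simp add: powr_def flip: exp_add)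
    then have *: "x powr (x + 1) \<le> (x + 1) powr (x + 1) * exp (- 1)"
      by (simp add: exp_minus field_simps)
    have "Gamma (x + 1 + 1) = (x + 1) * Gamma (x + 1)"
      by (rule Gamma_plus1) (use x in auto)
    also have "\<dots> \<le> (x + 1) * (5 * x powr (x + 1) * exp (- x))"
      using x IH by (intro mult_left_mono) auto
    also have "\<dots> \<le> (x + 1) * (5 * ((x + 1) powr (x + 1) * exp (- 1)) * exp (- x))"
      using x * by (intro mult_left_mono mult_right_mono) auto
    also have "\<dots> = 5 * (x + 1) powr (x + 1 + 1) * exp (- (x + 1))"
      using x by (simp add: powr_add exp_add exp_diff exp_minus power2_eq_square field_simps)
    finally show ?thesis unfolding x(2) .
  qed
qed

text \<open>The left side is \<open>exp (n / 2)\<close> times the total mass of the Gaussian with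
  exponent \<open>- n / 2 * |u|^2\<close>. Both sides contain the power \<open>n / 2\<close> of
  \<open>pi\<close>, because the volume of the ball is that power divided by
  \<open>Gamma (n / 2 + 1)\<close>; what is left is the Stirling bound.\<close>

lemma gaussian_le_unit_ball_vol:
  assumes "n \<ge> 1"
  shows "exp (real n / 2) * sqrt (pi / (real n / 2)) ^ n \<le> 5 / 2 * real n * unit_ball_vol (real n)"
proof -
  let ?x = "real n / 2"
  have x: "?x > 0" using assms by simp
  have G: "Gamma (?x + 1) > 0" using x by (intro Gamma_real_pos) simp
  have "sqrt y ^ n = y powr ?x" if "y > 0" for y :: real
    using that by (simp add: powr_half_sqrt[symmetric] powr_powr flip: powr_realpow)
  then have "sqrt (pi / ?x) ^ n = (pi / ?x) powr ?x" using x by (metis divide_pos_pos pi_gt_zero)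
  also have "\<dots> = pi powr ?x / ?x powr ?x" by (rule powr_divide)
  finally have 1: "sqrt (pi / ?x) ^ n = pi powr ?x / ?x powr ?x" .
  have "exp ?x * Gamma (?x + 1) \<le> exp ?x * (5 * ?x powr (?x + 1) * exp (- ?x))"
    by (intro mult_left_mono Gamma_half_nat_le assms) simp
  also have "\<dots> = 5 * ?x * ?x powr ?x"
    using x by (simp add: powr_add exp_minus)
  finally have "exp ?x * Gamma (?x + 1) \<le> 5 * ?x * ?x powr ?x" .
  then have "exp ?x / ?x powr ?x \<le> 5 * ?x / Gamma (?x + 1)"
    using G x by (simp add: field_simps)
  then have "exp ?x / ?x powr ?x * pi powr ?x \<le> 5 * ?x / Gamma (?x + 1) * pi powr ?x"
    by (rule mult_right_mono) simp
  then show ?thesis unfolding 1 unit_ball_vol_def by (simp add: mult_ac)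
qed

section \<open>Short columns of \<open>T\<close> and the volume estimate\<close>

context inverse_matrices
begin

text \<open>The volume of \<open>F\<close> is at most \<open>exp a\<close> times its Gaussian mass,
  and \<open>S\<close> maps \<open>F\<close> into the cube of half-side \<open>sqrt l\<close>, so
  this mass is bounded by that of a parallelepiped spanned by the columns of \<open>T\<close>. The
  box estimate gains a factor for each short column. The volume of the ball finally cancels, leaving
  an inequality between \<open>n\<close>, \<open>l\<close> and the number \<open>k\<close> of short
  columns.\<close>

lemma small_ball_bound:
  fixes l :: real
  assumes "n \<ge> 1" "l > 0"
    and E: "E \<in> sets (Leb {..<n})" "\<And>q i. q \<in> E \<Longrightarrow> i < n \<Longrightarrow> q i \<in> {-1..1}"
      "\<And>q. q \<in> E \<Longrightarrow> (\<Sum>j<n. (lmap n T q j)\<^sup>2) \<le> l"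
      "emeasure (Leb {..<n}) E \<ge> ennreal (49 / 50 * 2 ^ n)"
    and F: "F \<in> sets (Leb {..<n})" "\<And>u. u \<in> F \<Longrightarrow> (\<Sum>i<n. (u i)\<^sup>2) \<le> 1"
      "\<And>u i. u \<in> F \<Longrightarrow> i < n \<Longrightarrow> \<bar>lmap n S u i\<bar> \<le> sqrt l"
      "emeasure (Leb {..<n}) F \<ge> ennreal (49 / 50 * unit_ball_vol (real n))"
  shows "\<exists>k. n \<le> 2 * k \<and> 49 / 50 \<le> 5 / 2 * real n * (1 - exp (- 8 * l\<^sup>2) / 4) ^ k"
proof -
  let ?M = "Leb {..<n}"
  define a where "a = real n / 2"
  \<comment> \<open>The short columns. The threshold is twice the average \<open>4 * l / n\<close>
    permitted by the bound on the sum of squares, so by Markov's inequality at most half of the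
    columns exceed it.\<close>
  define H where "H = {i. i < n \<and> (\<Sum>j<n. (T j i)\<^sup>2) \<le> 8 * l / real n}"
  have a: "a > 0" using assms by (simp add: a_def)
  have H: "H \<subseteq> {..<n}" "finite H" by (auto simp: H_def)
  have Tq: "lmap n T q j = (\<Sum>i<n. q i * T j i)" if "j < n" for q j
    using that by (simp add: lmap_def mult.commute)
  have frob: "(\<Sum>i<n. \<Sum>j<n. (T j i)\<^sup>2) \<le> 4 * l"
  proof (rule sum_power2_le_of_small_ball[OF _ _ E(1)])
    show "q i \<in> {-1..1}" if "q \<in> E" "i \<in> {..<n}" for q i
      using E(2) that by blast
    show "(\<Sum>j<n. (\<Sum>i<n. q i * T j i)\<^sup>2) \<le> l" if "q \<in> E" for q
      using E(3)[OF that] by (simp add: Tq)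
  qed (use E(4) assms(2) in auto)
  have "real (card ({..<n} - H)) * (8 * l / real n) \<le> (\<Sum>i\<in>{..<n} - H. \<Sum>j<n. (T j i)\<^sup>2)"
    by (rule sum_bounded_below) (auto simp: H_def)
  also have "\<dots> \<le> (\<Sum>i<n. \<Sum>j<n. (T j i)\<^sup>2)"
    by (intro sum_mono2) (auto intro: sum_nonneg)
  also note frob
  finally have "real (card ({..<n} - H)) * 2 \<le> real n"
    using assms(1,2) by (simp add: field_simps)
  then have card: "n \<le> 2 * card H"
    using card_Diff_subset[OF H(2,1)] card_mono[OF _ H(1)] by simp
  define g where "g q = (\<Prod>i<n. indicator {- sqrt l..sqrt l} (q i)) * ennreal (exp (- a * (\<Sum>j<n. (\<Sum>i<n. q i * T j i)\<^sup>2)))" for q :: "nat \<Rightarrow> real"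
  define f where "f q = ennreal (exp (- a * (\<Sum>j<n. (\<Sum>i<n. q i * T j i)\<^sup>2)))" for q :: "nat \<Rightarrow> real"
  have g_meas: "g \<in> borel_measurable ?M" unfolding g_def by measurable
  have f_meas: "f \<in> borel_measurable ?M" unfolding f_def by measurable
  obtain \<kappa> where \<kappa>: "\<kappa> > 0" "\<forall>g \<in> borel_measurable ?M.
     (\<integral>\<^sup>+z. g (lmap n S z) \<partial>?M) = ennreal \<kappa> * (\<integral>\<^sup>+y. g y \<partial>?M)"
    using ex_jacobian by blast
  let ?\<delta> = "1 - exp (- 8 * l\<^sup>2) / 4"
  have "exp (- 8 * l\<^sup>2) \<le> 1" by simp
  then have \<delta>: "?\<delta> \<ge> 0" by linarith
  \<comment> \<open>The choice \<open>a = n / 2\<close> makes the loss per short column independent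
    of \<open>n\<close>.\<close>
  have exponent: "- 2 * (a * (8 * l / real n)) * (sqrt l)\<^sup>2 = - 8 * l\<^sup>2"
    using assms by (simp add: a_def power2_eq_square)
  have TSu: "(\<Sum>i<n. lmap n S u i * T j i) = u j" if "j < n" for u j
    using lmap_T_S[OF that, of u] Tq[OF that] by simp
  have "(\<integral>\<^sup>+q. g q \<partial>?M)
      \<le> ennreal (1 - exp (- 2 * (a * (8 * l / real n)) * (sqrt l)\<^sup>2) / 4) ^ card H * (\<integral>\<^sup>+q. f q \<partial>?M)"
    unfolding g_def f_def
    by (rule nn_integral_gaussian_box_le) (use a H assms(2) in \<open>auto simp: H_def\<close>)
  then have box: "(\<integral>\<^sup>+q. g q \<partial>?M) \<le> ennreal ?\<delta> ^ card H * (\<integral>\<^sup>+q. f q \<partial>?M)"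
    by (simp only: exponent)
  \<comment> \<open>Since \<open>T (S u) = u\<close>, the function \<open>f\<close> composed with
    \<open>S\<close> is the standard Gaussian. The unknown Jacobian therefore never has to be
    evaluated: it enters the final estimate only through this product.\<close>
  have "ennreal \<kappa> * (\<integral>\<^sup>+q. f q \<partial>?M) = (\<integral>\<^sup>+u. f (lmap n S u) \<partial>?M)"
    by (rule \<kappa>(2)[rule_format, OF f_meas, symmetric])
  also have "\<dots> = (\<integral>\<^sup>+u. ennreal (exp (- a * (\<Sum>j<n. (u j)\<^sup>2))) \<partial>?M)"
    by (simp add: f_def TSu)
  also have "\<dots> = ennreal (sqrt (pi / a) ^ n)"
    using nn_integral_gaussian_Leb[of "{..<n}" a] a by simp
  finally have total: "ennreal \<kappa> * (\<integral>\<^sup>+q. f q \<partial>?M) = ennreal (sqrt (pi / a) ^ n)" .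
  have "ennreal (49 / 50 * unit_ball_vol (real n)) \<le> (\<integral>\<^sup>+u. indicator F u \<partial>?M)"
    using F(1,4) by simp
  \<comment> \<open>On the ball \<open>exp (a - a * |u|^2)\<close> is at least 1, and for
    \<open>u\<close> in \<open>F\<close> all the coordinates of \<open>S u\<close> lie in the
    required interval.\<close>
  also have "\<dots> \<le> (\<integral>\<^sup>+u. ennreal (exp a) * g (lmap n S u) \<partial>?M)"
  proof (intro nn_integral_mono)
    fix u
    show "indicator F u \<le> ennreal (exp a) * g (lmap n S u)"
    proof (cases "u \<in> F")
      case True
      have "(\<Prod>i<n. indicator {- sqrt l..sqrt l} (lmap n S u i)) = (1 :: ennreal)"
      proof (intro prod.neutral ballI)
        fix i assume "i \<in> {..<n}"
        then show "indicator {- sqrt l..sqrt l} (lmap n S u i) = (1 :: ennreal)"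
          using F(3)[OF True, of i] by (auto simp: indicator_def abs_le_iff)
      qed
      then have "ennreal (exp a) * g (lmap n S u) = ennreal (exp a) * ennreal (exp (- a * (\<Sum>j<n. (u j)\<^sup>2)))"
        by (simp add: g_def TSu)
      also have "\<dots> = ennreal (exp (a - a * (\<Sum>j<n. (u j)\<^sup>2)))"
        by (simp add: exp_diff exp_minus divide_inverse flip: ennreal_mult)
      also have "\<dots> \<ge> 1"
        using mult_left_mono[OF F(2)[OF True], of a] a by (simp flip: ennreal_1 add: ennreal_leI)
      finally show ?thesis using True by simp
    qed simp
  qed
  also have "\<dots> = ennreal (exp a) * (\<integral>\<^sup>+u. g (lmap n S u) \<partial>?M)"
    by (rule nn_integral_cmult) (rule measurable_compose[OF lmap_measurable g_meas])
  also have "\<dots> = ennreal (exp a) * (ennreal \<kappa> * (\<integral>\<^sup>+q. g q \<partial>?M))"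
    by (simp only: \<kappa>(2)[rule_format, OF g_meas])
  also have "\<dots> \<le> ennreal (exp a) * (ennreal \<kappa> * (ennreal ?\<delta> ^ card H * (\<integral>\<^sup>+q. f q \<partial>?M)))"
    by (intro mult_left_mono box) simp_all
  also have "\<dots> = ennreal (exp a) * (ennreal ?\<delta> ^ card H * (ennreal \<kappa> * (\<integral>\<^sup>+q. f q \<partial>?M)))"
    by (simp only: mult_ac)
  also have "\<dots> = ennreal (exp a * sqrt (pi / a) ^ n * ?\<delta> ^ card H)"
    unfolding total using a \<delta> by (simp add: ennreal_power mult_ac flip: ennreal_mult)
  finally have "49 / 50 * unit_ball_vol (real n) \<le> exp a * sqrt (pi / a) ^ n * ?\<delta> ^ card H"
    using a \<delta> by (subst (asm) ennreal_le_iff) auto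
  also have "\<dots> \<le> 5 / 2 * real n * unit_ball_vol (real n) * ?\<delta> ^ card H"
    unfolding a_def using \<delta> by (intro mult_right_mono gaussian_le_unit_ball_vol assms(1)) auto
  finally have "unit_ball_vol (real n) * (49 / 50) \<le> unit_ball_vol (real n) * (5 / 2 * real n * ?\<delta> ^ card H)"
    by (simp only: mult_ac)
  then have "49 / 50 \<le> 5 / 2 * real n * ?\<delta> ^ card H"
    by (rule mult_left_le_imp_le) simp
  with card show ?thesis by blast
qed

end


section \<open>Convex bodies\<close>

lemma emeasure_Leb_isometry:
  assumes "finite I" "\<bar>c\<bar> = 1" "A \<in> sets (Leb I)"
  shows "emeasure (Leb I) {x \<in> space (Leb I). (\<lambda>i\<in>I. s i + c * x i) \<in> A} = emeasure (Leb I) A"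
proof -
  have "emeasure (Leb I) A = emeasure (distr (Leb I) (Leb I) (\<lambda>x. \<lambda>i\<in>I. s i + c * x i)) A"
    by (simp only: distr_Leb_isometry[OF assms(1,2)])
  also have "\<dots> = emeasure (Leb I) ((\<lambda>x. \<lambda>i\<in>I. s i + c * x i) -` A \<inter> space (Leb I))"
    using assms by (intro emeasure_distr) auto
  finally show ?thesis by (simp add: vimage_def Int_def conj_commute)
qed

text \<open>Inclusion-exclusion: \<open>D\<close> and its reflection \<open>D'\<close> both lie in
  the symmetric set \<open>K\<close> and fill at least 99 percent of it, so they share at least 98
  percent. The reflection is written \<open>0 + (-1) * x\<close> to match the form of the
  coordinatewise affine maps.\<close>

lemma emeasure_symmetric_part:
  fixes v :: real
  assumes "finite I" "D \<in> sets (Leb I)" "K \<in> sets (Leb I)" "D \<subseteq> K"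
    and sym: "\<forall>x\<in>space (Leb I). (\<lambda>i\<in>I. 0 + (-1) * x i) \<in> K \<longrightarrow> x \<in> K"
    and "emeasure (Leb I) K = ennreal v" "v \<ge> 0" "emeasure (Leb I) D \<ge> ennreal (99 / 100 * v)"
  defines "D' \<equiv> {x \<in> space (Leb I). (\<lambda>i\<in>I. 0 + (-1) * x i) \<in> D}"
  shows "D \<inter> D' \<in> sets (Leb I)" "emeasure (Leb I) (D \<inter> D') \<ge> ennreal (49 / 50 * v)"
proof -
  let ?M = "Leb I"
  have "(\<lambda>x. \<lambda>i\<in>I. 0 + (-1) * x i) \<in> ?M \<rightarrow>\<^sub>M ?M" by measurable
  then have D': "D' \<in> sets ?M" unfolding D'_def using assms(2) by measurable
  then show "D \<inter> D' \<in> sets ?M" using assms(2) by simp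
  have eD': "emeasure ?M D' = emeasure ?M D"
    unfolding D'_def by (rule emeasure_Leb_isometry[OF assms(1) _ assms(2)]) simp
  have K: "K \<in> fmeasurable ?M" using assms(3,6) by (intro fmeasurableI) auto
  have "D' \<subseteq> K" using sym assms(4) by (auto simp: D'_def)
  have fD: "D \<in> fmeasurable ?M" "D' \<in> fmeasurable ?M"
    by (rule fmeasurableI2[OF K assms(4,2)], rule fmeasurableI2[OF K \<open>D' \<subseteq> K\<close> D'])
  have "measure ?M (D \<union> D') \<le> measure ?M K"
  proof (rule measure_mono_fmeasurable[OF _ _ K])
    show "D \<union> D' \<subseteq> K" using assms(4) \<open>D' \<subseteq> K\<close> by simp
    show "D \<union> D' \<in> sets ?M" using assms(2) D' by simp
  qed
  also have "\<dots> = v" using assms(6,7) by (simp add: measure_def)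
  finally have "measure ?M D + measure ?M D' - measure ?M (D \<inter> D') \<le> v"
    using measure_Un3[OF fD] by simp
  moreover have "measure ?M D' = measure ?M D" using eD' by (simp add: measure_def)
  moreover have "99 / 100 * v \<le> measure ?M D"
    using assms(7,8) by (simp add: emeasure_eq_measure2[OF fD(1)])
  ultimately have "49 / 50 * v \<le> measure ?M (D \<inter> D')" by simp
  then show "emeasure ?M (D \<inter> D') \<ge> ennreal (49 / 50 * v)"
    using fD by (simp add: emeasure_eq_measure2 fmeasurable.Int ennreal_leI)
qed

lemma emeasure_box:
  "emeasure (Leb {..<n}) {q \<in> space (Leb {..<n}). \<forall>i<n. q i \<in> {-1..1}} = ennreal (2 ^ n)"
proof -
  interpret product_sigma_finite "\<lambda>_::nat. lborel :: real measure" by standard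
  have "{q \<in> space (Leb {..<n}). \<forall>i<n. q i \<in> {-1..1}} = Pi\<^sub>E {..<n} (\<lambda>_. {-1..1})"
    by (auto simp: space_PiM PiE_def Pi_def)
  also have "emeasure (Leb {..<n}) \<dots> = (\<Prod>i<n. emeasure lborel {-1..1::real})"
    by (rule emeasure_PiM) auto
  finally show ?thesis by (simp flip: ennreal_power)
qed

lemma emeasure_unit_ball:
  "emeasure (Leb {..<n}) {u \<in> space (Leb {..<n}). (\<Sum>i<n. (u i)\<^sup>2) \<le> 1} = ennreal (unit_ball_vol (real n))"
proof -
  have "{u \<in> space (Leb {..<n}). (\<Sum>i<n. (u i)\<^sup>2) \<le> 1}
      = {f. sqrt (\<Sum>i<n. (f i)\<^sup>2) \<le> 1} \<inter> space (Leb {..<n})" by auto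
  then show ?thesis using emeasure_cball_aux[of "{..<n}" 1] by simp
qed

section \<open>Passage from vectors to coordinate functions\<close>

text \<open>Completion does not change the measure of a measurable set, and
  \<open>Matrix.vec n\<close> is injective on extensional functions. Volumes of sets of vectors can
  thus be computed in \<open>Leb {..<n}\<close>, once membership is described in
  coordinates.\<close>

lemma Vol_eq_measure:
  assumes "P \<in> sets (Leb {..<n})" "A \<subseteq> carrier_vec n"
    and "\<And>f. f \<in> space (Leb {..<n}) \<Longrightarrow> f \<in> P \<longleftrightarrow> Matrix.vec n f \<in> A"
  shows "Vol n A = measure (Leb {..<n}) P"
proof -
  let ?M = "Leb {..<n}"
  have inj: "inj_on (Matrix.vec n) (space ?M)"
  proof (rule inj_onI)
    fix f g :: "nat \<Rightarrow> real" assume fg: "f \<in> space ?M" "g \<in> space ?M" "Matrix.vec n f = Matrix.vec n g"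
    show "f = g"
    proof (rule PiE_ext)
      show "f \<in> Pi\<^sub>E {..<n} (\<lambda>_. UNIV)" "g \<in> Pi\<^sub>E {..<n} (\<lambda>_. UNIV)" using fg by (auto simp: space_PiM)
      show "f i = g i" if "i \<in> {..<n}" for i
        using fg(3) that by (metis index_vec lessThan_iff)
    qed
  qed
  have A: "A = Matrix.vec n ` P"
  proof (intro equalityI subsetI)
    fix v assume v: "v \<in> A"
    then have "v = Matrix.vec n (\<lambda>i\<in>{..<n}. vec_index v i)" using assms(2) by (intro eq_vecI) auto
    moreover have "(\<lambda>i\<in>{..<n}. vec_index v i) \<in> space ?M" by (auto simp: space_PiM)
    ultimately show "v \<in> Matrix.vec n ` P" using v assms(3) by (metis imageI)
  next
    fix v assume "v \<in> Matrix.vec n ` P"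
    then show "v \<in> A" using assms(3) sets.sets_into_space[OF assms(1)] by auto
  qed
  have "Vol n A = measure (embed_measure ?M (Matrix.vec n)) A"
    unfolding lebesgue_vec_def A by (rule measure_completion) (rule in_sets_embed_measure[OF assms(1)])
  also have "\<dots> = measure ?M P"
    unfolding A measure_def by (simp add: emeasure_embed_measure_image'[OF inj assms(1)])
  finally show ?thesis .
qed

lemma vec_in_scale_set_iff:
  assumes "a > 0" "A \<subseteq> carrier_vec n"
  shows "Matrix.vec n f \<in> scale_set a A \<longleftrightarrow> Matrix.vec n (\<lambda>i. f i / a) \<in> A"
proof
  assume "Matrix.vec n f \<in> scale_set a A"
  then obtain v where v: "v \<in> A" "Matrix.vec n f = a \<cdot>\<^sub>v v" by (auto simp: scale_set_def)
  then have "v = Matrix.vec n (\<lambda>i. f i / a)"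
  proof (intro eq_vecI)
    fix i assume "i < dim_vec (Matrix.vec n (\<lambda>i. f i / a))"
    then have "i < n" by simp
    with v have "f i = a * vec_index v i"
      using assms(2) by (metis carrier_vecD index_smult_vec(1) index_vec subsetD)
    then show "vec_index v i = vec_index (Matrix.vec n (\<lambda>i. f i / a)) i" using \<open>i < n\<close> assms(1) by simp
  qed (use assms(2) in auto)
  then show "Matrix.vec n (\<lambda>i. f i / a) \<in> A" using v by simp
next
  assume "Matrix.vec n (\<lambda>i. f i / a) \<in> A"
  moreover have "Matrix.vec n f = a \<cdot>\<^sub>v Matrix.vec n (\<lambda>i. f i / a)"
    using assms(1) by (intro eq_vecI) auto
  ultimately show "Matrix.vec n f \<in> scale_set a A" unfolding scale_set_def by (metis imageI)
qed

lemma vec_in_translate_set_iff: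
  assumes "x \<in> carrier_vec n" "A \<subseteq> carrier_vec n"
  shows "Matrix.vec n f \<in> translate_set x A \<longleftrightarrow> Matrix.vec n (\<lambda>i. f i - vec_index x i) \<in> A"
proof
  assume "Matrix.vec n f \<in> translate_set x A"
  then obtain v where v: "v \<in> A" "Matrix.vec n f = x + v" by (auto simp: translate_set_def)
  then have "v = Matrix.vec n (\<lambda>i. f i - vec_index x i)"
  proof (intro eq_vecI)
    fix i assume "i < dim_vec (Matrix.vec n (\<lambda>i. f i - vec_index x i))"
    then have "i < n" by simp
    with v have "f i = vec_index x i + vec_index v i"
      using assms(2) by (metis carrier_vecD index_add_vec(1) index_vec subsetD)
    then show "vec_index v i = vec_index (Matrix.vec n (\<lambda>i. f i - vec_index x i)) i" using \<open>i < n\<close> by simp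
  qed (use assms(2) in auto)
  then show "Matrix.vec n (\<lambda>i. f i - vec_index x i) \<in> A" using v by simp
next
  assume "Matrix.vec n (\<lambda>i. f i - vec_index x i) \<in> A"
  moreover have "Matrix.vec n f = x + Matrix.vec n (\<lambda>i. f i - vec_index x i)"
    using assms(1) by (intro eq_vecI) auto
  ultimately show "Matrix.vec n f \<in> translate_set x A" unfolding translate_set_def by (metis imageI)
qed

lemma vec_in_cube_iff: "Matrix.vec n f \<in> cube n \<longleftrightarrow> (\<forall>i<n. f i \<in> {-1..1})"
  by (auto simp: cube_def)

lemma vec_in_unit_ball_iff: "Matrix.vec n f \<in> unit_ball n \<longleftrightarrow> (\<Sum>i<n. (f i)\<^sup>2) \<le> 1"
proof -
  have "(\<Sum>i<n. (vec_index (Matrix.vec n f) i)\<^sup>2) = (\<Sum>i<n. (f i)\<^sup>2)" by (intro sum.cong) auto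
  then show ?thesis by (simp add: unit_ball_def euclidean_norm_def)
qed

lemma mult_mat_vec_eq_lmap:
  assumes "T \<in> carrier_mat n n"
  shows "T *\<^sub>v Matrix.vec n f = Matrix.vec n (lmap n (\<lambda>i j. T $$ (i, j)) f)"
  using assms by (intro eq_vecI) (auto simp: lmap_def scalar_prod_def lessThan_atLeast0 intro!: sum.cong)

lemma invertible_mat_imp_inverse_matrices:
  fixes T :: "real mat"
  assumes "T \<in> carrier_mat n n" "invertible_mat T"
  obtains S where "S \<in> carrier_mat n n" "inverse_matrices n (\<lambda>i j. S $$ (i, j)) (\<lambda>i j. T $$ (i, j))"
proof -
  obtain S where S: "inverts_mat T S" "inverts_mat S T" using assms by (auto simp: invertible_mat_def)
  \<comment> \<open>Being an inverse does not fix the dimensions of \<open>S\<close> by definition;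
    they are read off from the identity matrices that the two products equal.\<close>
  have "dim_row S = dim_col (S * T)" using S(2) unfolding inverts_mat_def by (metis index_one_mat(3))
  moreover have "dim_col S = dim_col (T * S)" by simp
  ultimately have carr: "S \<in> carrier_mat n n"
    using S(1) assms(1) unfolding inverts_mat_def by (metis carrier_matD carrier_matI index_mult_mat(3) index_one_mat(3))
  have entry: "(\<Sum>k<n. A $$ (i, k) * B $$ (k, j)) = (if i = j then 1 else 0)"
    if "A \<in> carrier_mat n n" "B \<in> carrier_mat n n" "inverts_mat A B" "i < n" "j < n" for A B :: "real mat" and i j
  proof -
    have "(A * B) $$ (i, j) = (\<Sum>k<n. A $$ (i, k) * B $$ (k, j))"
      using that by (auto simp: scalar_prod_def lessThan_atLeast0 intro!: sum.cong)
    moreover have "A * B = 1\<^sub>m n" using that by (auto simp: inverts_mat_def)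
    ultimately show ?thesis using that by simp
  qed
  show ?thesis
    by (rule that[OF carr], unfold_locales) (use entry assms carr S in auto)
qed

lemma vec_in_linear_image_iff:
  assumes "T \<in> carrier_mat n n" "A \<subseteq> carrier_vec n"
    and "inverse_matrices n S (\<lambda>i j. T $$ (i, j))"
  shows "Matrix.vec n f \<in> linear_image T A \<longleftrightarrow> Matrix.vec n (lmap n S f) \<in> A"
proof -
  interpret inverse_matrices n S "\<lambda>i j. T $$ (i, j)" by fact
  let ?T = "\<lambda>i j. T $$ (i, j)"
  show ?thesis
  proof
    assume "Matrix.vec n f \<in> linear_image T A"
    then obtain v where v: "v \<in> A" "Matrix.vec n f = T *\<^sub>v v" by (auto simp: linear_image_def)
    then have "v \<in> carrier_vec n" using assms(2) by blast
    then have v_eq: "v = Matrix.vec n (vec_index v)" by (intro eq_vecI) auto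
    have fi: "f i = lmap n ?T (vec_index v) i" if "i < n" for i
      using v(2) mult_mat_vec_eq_lmap[OF assms(1), of "vec_index v"] v_eq that by (metis index_vec)
    have "lmap n S f = lmap n S (lmap n ?T (vec_index v))"
      unfolding lmap_def[of n S] by (intro restrict_ext sum.cong) (auto simp: fi)
    then have "Matrix.vec n (lmap n S f) = v"
      using \<open>v \<in> carrier_vec n\<close> by (intro eq_vecI) (auto simp: lmap_S_T)
    then show "Matrix.vec n (lmap n S f) \<in> A" using v by simp
  next
    assume "Matrix.vec n (lmap n S f) \<in> A"
    moreover have "Matrix.vec n f = T *\<^sub>v Matrix.vec n (lmap n S f)"
      unfolding mult_mat_vec_eq_lmap[OF assms(1)] by (intro eq_vecI) (auto simp: lmap_T_S)
    ultimately show "Matrix.vec n f \<in> linear_image T A" unfolding linear_image_def by (metis imageI)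
  qed
qed

lemma subset_carrier_vec:
  "cube n \<subseteq> carrier_vec n" "unit_ball n \<subseteq> carrier_vec n"
  "A \<subseteq> carrier_vec n \<Longrightarrow> scale_set a A \<subseteq> carrier_vec n"
  "A \<subseteq> carrier_vec n \<Longrightarrow> x \<in> carrier_vec n \<Longrightarrow> translate_set x A \<subseteq> carrier_vec n"
  "A \<subseteq> carrier_vec n \<Longrightarrow> T \<in> carrier_mat n n \<Longrightarrow> linear_image T A \<subseteq> carrier_vec n"
  by (auto simp: cube_def unit_ball_def scale_set_def translate_set_def linear_image_def)


lemma lmap_affine:
  "i < n \<Longrightarrow> lmap n A (\<lambda>i\<in>{..<n}. s i + c * q i) i = lmap n A s i + c * lmap n A q i"
  by (simp add: lmap_def sum.distrib sum_distrib_left algebra_simps)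

text \<open>One factor \<open>\<kappa>\<close> serves for all \<open>A\<close>, so ratios of volumes
  are preserved and the 99 percent condition can be pulled back through \<open>S\<close>.\<close>

lemma (in inverse_matrices) measure_lmap_vimage:
  "\<exists>\<kappa>>0. \<forall>A\<in>sets (Leb {..<n}).
    measure (Leb {..<n}) {z \<in> space (Leb {..<n}). lmap n S z \<in> A} = \<kappa> * measure (Leb {..<n}) A"
proof -
  let ?M = "Leb {..<n}"
  obtain \<kappa> where \<kappa>: "\<kappa> > 0" "\<forall>g \<in> borel_measurable ?M.
     (\<integral>\<^sup>+z. g (lmap n S z) \<partial>?M) = ennreal \<kappa> * (\<integral>\<^sup>+y. g y \<partial>?M)"
    using ex_jacobian by blast
  have "measure ?M {z \<in> space ?M. lmap n S z \<in> A} = \<kappa> * measure ?M A" if A: "A \<in> sets ?M" for A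
  proof -
    have B: "{z \<in> space ?M. lmap n S z \<in> A} \<in> sets ?M"
      using measurable_sets[OF lmap_measurable A] by (simp add: vimage_def Int_def conj_commute)
    have "emeasure ?M {z \<in> space ?M. lmap n S z \<in> A} = (\<integral>\<^sup>+z. indicator {z \<in> space ?M. lmap n S z \<in> A} z \<partial>?M)"
      using B by simp
    also have "\<dots> = (\<integral>\<^sup>+z. indicator A (lmap n S z) \<partial>?M)"
      by (rule nn_integral_cong) (simp add: indicator_def)
    also have "\<dots> = ennreal \<kappa> * (\<integral>\<^sup>+z. indicator A z \<partial>?M)"
      using A by (intro \<kappa>(2)[rule_format]) simp
    also have "\<dots> = ennreal \<kappa> * emeasure ?M A"
      using A by simp
    finally show ?thesis using \<kappa>(1) by (simp add: measure_def enn2real_mult)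
  qed
  with \<kappa>(1) show ?thesis by blast
qed

section \<open>From partial containment to the volume inequality\<close>

text \<open>In the coordinates \<open>q = S f - x\<close> the body \<open>K1\<close> becomes the
  cube, and in \<open>u = f - y\<close> the body \<open>K2\<close> becomes the ball. The two
  conditions then describe large subsets \<open>D\<close> of the cube and \<open>G\<close> of the
  ball, in which the translations survive only as constant offsets \<open>w\<close> and
  \<open>s\<close>. Passing to symmetric parts eliminates these offsets.\<close>

lemma partially_contained_cube_ball_bound:
  fixes l :: real
  assumes "n \<ge> 1" "l \<ge> 1" and T: "T \<in> carrier_mat n n" "invertible_mat T"
    and xy: "x \<in> carrier_vec n" "y \<in> carrier_vec n"
    and pc: "partially_contained n l (linear_image T (translate_set x (cube n))) (translate_set y (unit_ball n))"
      "partially_contained n l (translate_set y (unit_ball n)) (linear_image T (translate_set x (cube n)))"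
  shows "\<exists>k. n \<le> 2 * k \<and> 49 / 50 \<le> 5 / 2 * real n * (1 - exp (- 8 * l\<^sup>2) / 4) ^ k"
proof -
  obtain S' where inv: "inverse_matrices n (\<lambda>i j. S' $$ (i, j)) (\<lambda>i j. T $$ (i, j))"
    using invertible_mat_imp_inverse_matrices[OF T] by blast
  define S where "S i j = S' $$ (i, j)" for i j
  define T' where "T' i j = T $$ (i, j)" for i j
  interpret inverse_matrices n S T' using inv by (simp add: S_def[abs_def] T'_def[abs_def])
  have inv: "inverse_matrices n S (\<lambda>i j. T $$ (i, j))" using inv by (simp add: S_def[abs_def])
  let ?M = "Leb {..<n}"
  define X where "X = vec_index x"
  define Y where "Y = vec_index y"
  define \<tau> where "\<tau> = sqrt l"
  have \<tau>: "\<tau> > 0" "\<tau>\<^sup>2 = l" using assms(2) by (auto simp: \<tau>_def)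
  let ?K1 = "linear_image T (translate_set x (cube n))" and ?K2 = "translate_set y (unit_ball n)"
  note carr = subset_carrier_vec(4)[OF subset_carrier_vec(1) xy(1)] subset_carrier_vec(4)[OF subset_carrier_vec(2) xy(2)]
  note carr = carr subset_carrier_vec(5)[OF carr(1) T(1)]
  have in_K1: "Matrix.vec n f \<in> ?K1 \<longleftrightarrow> (\<forall>i<n. \<bar>lmap n S f i - X i\<bar> \<le> 1)" for f
    unfolding vec_in_linear_image_iff[OF T(1) carr(1) inv] vec_in_translate_set_iff[OF xy(1) subset_carrier_vec(1)]
      vec_in_cube_iff by (auto simp: X_def abs_le_iff)
  have in_K2: "Matrix.vec n f \<in> ?K2 \<longleftrightarrow> (\<Sum>i<n. (f i - Y i)\<^sup>2) \<le> 1" for f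
    unfolding vec_in_translate_set_iff[OF xy(2) subset_carrier_vec(2)] vec_in_unit_ball_iff by (simp add: Y_def)
  have in_sK1: "Matrix.vec n f \<in> scale_set \<tau> ?K1 \<longleftrightarrow> (\<forall>i<n. \<bar>lmap n S f i - \<tau> * X i\<bar> \<le> \<tau>)" for f
  proof -
    have "\<bar>lmap n S (\<lambda>i. f i / \<tau>) i - X i\<bar> \<le> 1 \<longleftrightarrow> \<bar>lmap n S f i - \<tau> * X i\<bar> \<le> \<tau>" if "i < n" for i
    proof -
      have "lmap n S (\<lambda>i. f i / \<tau>) i - X i = (lmap n S f i - \<tau> * X i) / \<tau>"
        using \<tau> that by (simp add: lmap_def sum_divide_distrib diff_divide_distrib)
      then show ?thesis using \<tau> by (simp add: abs_divide divide_le_eq)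
    qed
    then show ?thesis unfolding vec_in_scale_set_iff[OF \<tau>(1) carr(3)] in_K1 by blast
  qed
  have in_sK2: "Matrix.vec n f \<in> scale_set \<tau> ?K2 \<longleftrightarrow> (\<Sum>i<n. (f i - \<tau> * Y i)\<^sup>2) \<le> l" for f
  proof -
    have "(\<Sum>i<n. (f i / \<tau> - Y i)\<^sup>2) = (\<Sum>i<n. (f i - \<tau> * Y i)\<^sup>2) / l"
      unfolding sum_divide_distrib \<tau>(2)[symmetric] using \<tau>(1)
      by (intro sum.cong) (auto simp: field_simps power2_eq_square)
    then show ?thesis unfolding vec_in_scale_set_iff[OF \<tau>(1) carr(2)] in_K2
      using assms(2) by (simp add: divide_le_eq)
  qed
  note meas [measurable] = lmap_coord_measurable
  define box where "box = {q \<in> space ?M. \<forall>i<n. q i \<in> {-1..1}}"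
  define ball where "ball = {u \<in> space ?M. (\<Sum>i<n. (u i)\<^sup>2) \<le> 1}"
  have box_sets: "box \<in> sets ?M" unfolding box_def by measurable
  have ball_sets: "ball \<in> sets ?M" unfolding ball_def by measurable
  have box_measure: "emeasure ?M box = ennreal (2 ^ n)" unfolding box_def by (rule emeasure_box)
  have ball_measure: "emeasure ?M ball = ennreal (unit_ball_vol (real n))" unfolding ball_def by (rule emeasure_unit_ball)
  \<comment> \<open>The offsets are determined by \<open>f - \<tau> y = T q + w\<close> for
    \<open>q = S f - x\<close>, and by \<open>S f - \<tau> x = S u + s\<close> for
    \<open>u = f - y\<close>; scaling a body also scales its translation vector.\<close>
  define w where "w i = lmap n T' X i - \<tau> * Y i" for i
  define s where "s i = lmap n S Y i - \<tau> * X i" for i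
  define D where "D = {q \<in> space ?M. (\<forall>i<n. q i \<in> {-1..1}) \<and> (\<Sum>i<n. (lmap n T' q i + w i)\<^sup>2) \<le> l}"
  define G where "G = {u \<in> space ?M. (\<Sum>i<n. (u i)\<^sup>2) \<le> 1 \<and> (\<forall>i<n. \<bar>lmap n S u i + s i\<bar> \<le> \<tau>)}"
  have D_box: "D \<subseteq> box" by (auto simp: D_def box_def)
  have G_ball: "G \<subseteq> ball" by (auto simp: G_def ball_def)
  have D_sets: "D \<in> sets ?M" unfolding D_def by measurable
  have G_sets: "G \<in> sets ?M" unfolding G_def by measurable
  have shift_sets: "{q \<in> space ?M. (\<lambda>i\<in>{..<n}. a i + 1 * q i) \<in> A} \<in> sets ?M" if "A \<in> sets ?M" for A and a :: "nat \<Rightarrow> real"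
  proof -
    have "(\<lambda>q. \<lambda>i\<in>{..<n}. a i + 1 * q i) \<in> ?M \<rightarrow>\<^sub>M ?M"
      by (rule measurable_restrict) (use meas(2) in simp)
    from measurable_sets[OF this that] show ?thesis by (simp add: vimage_def Int_def conj_commute)
  qed
  have shift_space: "(\<lambda>i\<in>{..<n}. f i) \<in> space ?M" for f :: "nat \<Rightarrow> real" by (simp add: space_PiM)
  have lmap_space: "lmap n S z \<in> space ?M" for z by (simp add: lmap_def space_PiM)
  have lmap_sets: "{z \<in> space ?M. lmap n S z \<in> A} \<in> sets ?M" if "A \<in> sets ?M" for A
    using measurable_sets[OF lmap_measurable that, of S] by (simp add: vimage_def Int_def conj_commute)
  have shift_measure: "measure ?M {q \<in> space ?M. (\<lambda>i\<in>{..<n}. a i + 1 * q i) \<in> A} = measure ?M A"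
    if "A \<in> sets ?M" for A and a :: "nat \<Rightarrow> real"
    unfolding measure_def using emeasure_Leb_isometry[OF _ _ that, of 1 a] by simp

  have E: "emeasure ?M D \<ge> ennreal (99 / 100 * 2 ^ n)"
  proof -
    let ?s = "\<lambda>A. {q \<in> space ?M. (\<lambda>i\<in>{..<n}. - X i + 1 * q i) \<in> A}"
    let ?l = "\<lambda>A. {z \<in> space ?M. lmap n S z \<in> A}"
    obtain \<kappa> where \<kappa>: "\<kappa> > 0" "\<forall>A\<in>sets ?M. measure ?M (?l A) = \<kappa> * measure ?M A"
      using measure_lmap_vimage by blast
    have Vol1: "Vol n ?K1 = measure ?M (?l (?s box))"
    proof (rule Vol_eq_measure[OF lmap_sets[OF shift_sets[OF box_sets]] carr(3)])
      show "f \<in> ?l (?s box) \<longleftrightarrow> Matrix.vec n f \<in> ?K1" if "f \<in> space ?M" for f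
        using that lmap_space shift_space unfolding in_K1 by (auto simp: box_def abs_le_iff)
    qed
    have Vol2: "Vol n (scale_set \<tau> ?K2 \<inter> ?K1) = measure ?M (?l (?s D))"
    proof (rule Vol_eq_measure[OF lmap_sets[OF shift_sets[OF D_sets]]])
      show "scale_set \<tau> ?K2 \<inter> ?K1 \<subseteq> carrier_vec n" using carr(3) by blast
      show "f \<in> ?l (?s D) \<longleftrightarrow> Matrix.vec n f \<in> scale_set \<tau> ?K2 \<inter> ?K1" if "f \<in> space ?M" for f
      proof -
        let ?q = "\<lambda>i\<in>{..<n}. - X i + 1 * lmap n S f i"
        have neg: "lmap n T' (\<lambda>i. - X i) i = - lmap n T' X i" if "i < n" for i
          using that by (simp add: lmap_def sum_negf)
        have "lmap n T' ?q i + w i = f i - \<tau> * Y i" if "i < n" for i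
          unfolding lmap_affine[OF that] neg[OF that] by (simp add: w_def lmap_T_S that)
        then have "(\<Sum>i<n. (lmap n T' ?q i + w i)\<^sup>2) = (\<Sum>i<n. (f i - \<tau> * Y i)\<^sup>2)"
          by (intro sum.cong) auto
        then have "?q \<in> D \<longleftrightarrow> (\<forall>i<n. \<bar>lmap n S f i - X i\<bar> \<le> 1) \<and> (\<Sum>i<n. (f i - \<tau> * Y i)\<^sup>2) \<le> l"
          unfolding D_def using shift_space[of "\<lambda>i. - X i + 1 * lmap n S f i"] by (auto simp: abs_le_iff)
        then show ?thesis using that lmap_space by (auto simp: in_K1 in_sK2)
      qed
    qed
    \<comment> \<open>Both volumes carry the same factor \<open>\<kappa>\<close>, which
      cancels.\<close>
    have "99 / 100 * (\<kappa> * measure ?M box) \<le> \<kappa> * measure ?M D"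
      using pc(1) unfolding partially_contained_def \<tau>_def[symmetric] Vol1 Vol2
      by (simp only: \<kappa>(2)[rule_format] shift_sets box_sets D_sets shift_measure)
    then have "\<kappa> * (99 / 100 * measure ?M box) \<le> \<kappa> * measure ?M D" by simp
    then have "99 / 100 * measure ?M box \<le> measure ?M D" using \<kappa>(1) by (simp only: mult_le_cancel_left_pos)
    moreover have "measure ?M box = 2 ^ n"
      by (simp add: measure_def box_measure)
    moreover have "emeasure ?M D = ennreal (measure ?M D)"
    proof (rule emeasure_eq_measure2, rule fmeasurableI2[OF _ D_box D_sets])
      show "box \<in> fmeasurable ?M" using box_sets box_measure by (intro fmeasurableI) simp_all
    qed
    ultimately show ?thesis by (simp add: ennreal_leI)
  qed
  have F: "emeasure ?M G \<ge> ennreal (99 / 100 * unit_ball_vol (real n))"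
  proof -
    let ?s = "\<lambda>A. {q \<in> space ?M. (\<lambda>i\<in>{..<n}. - Y i + 1 * q i) \<in> A}"
    have Vol1: "Vol n ?K2 = measure ?M (?s ball)"
    proof (rule Vol_eq_measure[OF shift_sets[OF ball_sets] carr(2)])
      show "f \<in> ?s ball \<longleftrightarrow> Matrix.vec n f \<in> ?K2" if "f \<in> space ?M" for f
        using that shift_space unfolding in_K2 by (auto simp: ball_def)
    qed
    have Vol2: "Vol n (scale_set \<tau> ?K1 \<inter> ?K2) = measure ?M (?s G)"
    proof (rule Vol_eq_measure[OF shift_sets[OF G_sets]])
      show "scale_set \<tau> ?K1 \<inter> ?K2 \<subseteq> carrier_vec n" using carr(2) by blast
      show "f \<in> ?s G \<longleftrightarrow> Matrix.vec n f \<in> scale_set \<tau> ?K1 \<inter> ?K2" if "f \<in> space ?M" for f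
      proof -
        let ?u = "\<lambda>i\<in>{..<n}. - Y i + 1 * f i"
        have neg: "lmap n S (\<lambda>i. - Y i) i = - lmap n S Y i" if "i < n" for i
          using that by (simp add: lmap_def sum_negf)
        have "lmap n S ?u i + s i = lmap n S f i - \<tau> * X i" if "i < n" for i
          unfolding lmap_affine[OF that] neg[OF that] by (simp add: s_def)
        moreover have "(\<Sum>i<n. (?u i)\<^sup>2) = (\<Sum>i<n. (f i - Y i)\<^sup>2)"
          by (intro sum.cong) auto
        ultimately have "?u \<in> G \<longleftrightarrow> (\<forall>i<n. \<bar>lmap n S f i - \<tau> * X i\<bar> \<le> \<tau>) \<and> (\<Sum>i<n. (f i - Y i)\<^sup>2) \<le> 1"
          unfolding G_def using shift_space[of "\<lambda>i. - Y i + 1 * f i"] by auto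
        then show ?thesis using that by (auto simp: in_K2 in_sK1)
      qed
    qed
    have "99 / 100 * measure ?M ball \<le> measure ?M G"
      using pc(2) unfolding partially_contained_def \<tau>_def[symmetric] Vol1 Vol2
      by (simp only: shift_sets ball_sets G_sets shift_measure)
    moreover have "measure ?M ball = unit_ball_vol (real n)"
      by (simp add: measure_def ball_measure)
    moreover have "emeasure ?M G = ennreal (measure ?M G)"
    proof (rule emeasure_eq_measure2, rule fmeasurableI2[OF _ G_ball G_sets])
      show "ball \<in> fmeasurable ?M" using ball_sets ball_measure by (intro fmeasurableI) simp_all
    qed
    ultimately show ?thesis by (simp add: ennreal_leI)
  qed
  define E where "E = D \<inter> {q \<in> space ?M. (\<lambda>i\<in>{..<n}. 0 + (-1) * q i) \<in> D}"
  define F where "F = G \<inter> {q \<in> space ?M. (\<lambda>i\<in>{..<n}. 0 + (-1) * q i) \<in> G}"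
  have box_sym: "\<forall>q\<in>space ?M. (\<lambda>i\<in>{..<n}. 0 + (-1) * q i) \<in> box \<longrightarrow> q \<in> box"
    by (auto simp: box_def)
  have ball_sym: "\<forall>q\<in>space ?M. (\<lambda>i\<in>{..<n}. 0 + (-1) * q i) \<in> ball \<longrightarrow> q \<in> ball"
    by (auto simp: ball_def)
  have E': "E \<in> sets ?M" "emeasure ?M E \<ge> ennreal (49 / 50 * 2 ^ n)"
    unfolding E_def
    by (rule emeasure_symmetric_part[OF _ D_sets box_sets D_box box_sym box_measure _ E]; simp)+
  have F': "F \<in> sets ?M" "emeasure ?M F \<ge> ennreal (49 / 50 * unit_ball_vol (real n))"
    unfolding F_def
    by (rule emeasure_symmetric_part[OF _ G_sets ball_sets G_ball ball_sym ball_measure _ F]; simp)+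
  have neg: "lmap n A (\<lambda>i\<in>{..<n}. 0 + (-1) * q i) i = - lmap n A q i" if "i < n" for A q i
    using that by (simp add: lmap_def sum_negf)
  show ?thesis
  proof (rule small_ball_bound[OF assms(1) _ E'(1) _ _ E'(2) F'(1) _ _ F'(2)])
    show "0 < l" using assms(2) by simp
    show "q i \<in> {-1..1}" if "q \<in> E" "i < n" for q i
      using that by (auto simp: E_def D_def)
    show "(\<Sum>i<n. (u i)\<^sup>2) \<le> 1" if "u \<in> F" for u
      using that by (auto simp: F_def G_def)
    show "\<bar>lmap n S u i\<bar> \<le> sqrt l" if "u \<in> F" "i < n" for u i
    proof -
      \<comment> \<open>Both \<open>a + s\<close> and \<open>-a + s\<close> are at most
        \<open>\<tau>\<close> in absolute value, hence so is \<open>a\<close>, half of their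
        difference.\<close>
      have "\<bar>lmap n S u i + s i\<bar> \<le> \<tau>" "\<bar>lmap n S (\<lambda>i\<in>{..<n}. 0 + (-1) * u i) i + s i\<bar> \<le> \<tau>"
        using that unfolding F_def G_def by blast+
      then show ?thesis unfolding neg[OF that(2)] \<tau>_def by linarith
    qed
    show "(\<Sum>j<n. (lmap n T' q j)\<^sup>2) \<le> l" if "q \<in> E" for q
    proof -
      have 1: "(\<Sum>i<n. (lmap n T' q i + w i)\<^sup>2) \<le> l" using that by (auto simp: E_def D_def)
      have "(\<Sum>i<n. (lmap n T' (\<lambda>i\<in>{..<n}. 0 + (-1) * q i) i + w i)\<^sup>2) \<le> l"
        using that unfolding E_def D_def by blast
      moreover have "(\<Sum>i<n. (lmap n T' (\<lambda>i\<in>{..<n}. 0 + (-1) * q i) i + w i)\<^sup>2) = (\<Sum>i<n. (- lmap n T' q i + w i)\<^sup>2)"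
        by (rule sum.cong[OF refl]) (simp only: neg lessThan_iff)
      ultimately have 2: "(\<Sum>i<n. (- lmap n T' q i + w i)\<^sup>2) \<le> l"
        by simp
      \<comment> \<open>The parallelogram identity with the nonnegative contribution of
        \<open>w\<close> dropped.\<close>
      have "2 * (\<Sum>j<n. (lmap n T' q j)\<^sup>2) \<le> (\<Sum>i<n. (lmap n T' q i + w i)\<^sup>2) + (\<Sum>i<n. (- lmap n T' q i + w i)\<^sup>2)"
        unfolding sum_distrib_left sum.distrib[symmetric]
        by (intro sum_mono) (simp add: power2_eq_square algebra_simps)
      then show ?thesis using 1 2 by linarith
    qed
  qed
qed

text \<open>Needed only to show that the infimum is taken over a nonempty set. The value
  \<open>n^2\<close> makes the scaling factor equal to \<open>n\<close>, for which both full
  inclusions hold by crude coordinate estimates.\<close>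

lemma cube_ball_admissible:
  assumes "n \<ge> 1"
  shows "partially_contained n ((real n)\<^sup>2) (cube n) (unit_ball n)"
    "partially_contained n ((real n)\<^sup>2) (unit_ball n) (cube n)"
proof -
  have n: "real n \<ge> 1" using assms by simp
  have vec_eq: "v = Matrix.vec n (vec_index v)" if "v \<in> carrier_vec n" for v :: rvec
    using that by (intro eq_vecI) auto
  have "v \<in> scale_set (real n) (unit_ball n)" if "v \<in> cube n" for v
  proof -
    have v: "v \<in> carrier_vec n" "\<forall>i<n. \<bar>vec_index v i\<bar> \<le> 1" using that by (auto simp: cube_def abs_le_iff)
    have "(\<Sum>i<n. (vec_index v i / real n)\<^sup>2) \<le> (\<Sum>i<n. 1 / real n)"
    proof (intro sum_mono)
      fix i assume "i \<in> {..<n}"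
      then have "(vec_index v i)\<^sup>2 \<le> 1" using v by (simp add: abs_square_le_1)
      then have "(vec_index v i / real n)\<^sup>2 \<le> 1 / (real n)\<^sup>2" by (simp add: power_divide divide_right_mono)
      also have "\<dots> \<le> 1 / real n" using n by (intro divide_left_mono) (auto simp: power2_eq_square)
      finally show "(vec_index v i / real n)\<^sup>2 \<le> 1 / real n" .
    qed
    also have "\<dots> = 1" using n by simp
    finally have "Matrix.vec n (vec_index v) \<in> scale_set (real n) (unit_ball n)"
      using n by (subst vec_in_scale_set_iff) (auto simp: subset_carrier_vec vec_in_unit_ball_iff)
    then show ?thesis using vec_eq[OF v(1)] by simp
  qed
  then have "scale_set (real n) (unit_ball n) \<inter> cube n = cube n" by blast
  then show "partially_contained n ((real n)\<^sup>2) (cube n) (unit_ball n)"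
    by (simp add: partially_contained_def)
  have "v \<in> scale_set (real n) (cube n)" if "v \<in> unit_ball n" for v
  proof -
    have v: "v \<in> carrier_vec n" "(\<Sum>i<n. (vec_index v i)\<^sup>2) \<le> 1"
      using that by (auto simp: unit_ball_def euclidean_norm_def)
    have "vec_index v i / real n \<in> {-1..1}" if "i < n" for i
    proof -
      have "(vec_index v i)\<^sup>2 \<le> (\<Sum>i<n. (vec_index v i)\<^sup>2)"
        using that by (intro member_le_sum) auto
      with v(2) have "\<bar>vec_index v i\<bar> \<le> 1" by (simp add: abs_square_le_1[symmetric])
      with n show ?thesis by (auto simp: field_simps abs_le_iff)
    qed
    then have "Matrix.vec n (vec_index v) \<in> scale_set (real n) (cube n)"
      using n by (subst vec_in_scale_set_iff) (auto simp: subset_carrier_vec vec_in_cube_iff)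
    then show ?thesis using vec_eq[OF v(1)] by simp
  qed
  then have "scale_set (real n) (cube n) \<inter> unit_ball n = unit_ball n" by blast
  then show "partially_contained n ((real n)\<^sup>2) (unit_ball n) (cube n)"
    by (simp add: partially_contained_def)
qed

section \<open>Large dimensions and the universal constant\<close>

text \<open>If \<open>l\<close> is below \<open>sqrt (ln n) / 4\<close>, then \<open>8 * l^2\<close>
  is below \<open>ln n / 2\<close>, so each of the \<open>k\<close> factors is at most
  \<open>1 - 1 / (4 * sqrt n)\<close>. As \<open>k\<close> is at least \<open>n / 2\<close>, their
  product is at most \<open>exp (- sqrt n / 8)\<close>, which beats the linear prefactor for large
  \<open>n\<close>. The constant 1/4 is chosen to make the critical power of \<open>n\<close> equal
  to -1/2.\<close>

lemma sqrt_ln_le_of_large_dimension: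
  "\<exists>N::nat. N \<ge> 2 \<and> (\<forall>n\<ge>N. \<forall>l k. 0 \<le> l \<longrightarrow> n \<le> 2 * k \<longrightarrow>
     49 / 50 \<le> 5 / 2 * real n * (1 - exp (- 8 * l\<^sup>2) / 4) ^ k \<longrightarrow> sqrt (ln (real n)) / 4 \<le> l)"
proof -
  have "eventually (\<lambda>n::nat. 5 / 2 * real n * exp (- sqrt (real n) / 8) < 49 / 50) at_top"
    by real_asymp
  then obtain N where N: "\<And>n. n \<ge> N \<Longrightarrow> 5 / 2 * real n * exp (- sqrt (real n) / 8) < 49 / 50"
    by (auto simp: eventually_at_top_linorder)
  show ?thesis
  proof (intro exI[of _ "max N 2"] conjI allI impI)
    fix n k :: nat and l :: real
    assume n: "n \<ge> max N 2" and l: "0 \<le> l" and k: "n \<le> 2 * k"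
      and *: "49 / 50 \<le> 5 / 2 * real n * (1 - exp (- 8 * l\<^sup>2) / 4) ^ k"
    show "sqrt (ln (real n)) / 4 \<le> l"
    proof (rule ccontr)
      assume "\<not> sqrt (ln (real n)) / 4 \<le> l"
      then have "4 * l < sqrt (ln (real n))" by simp
      then have "(4 * l)\<^sup>2 < (sqrt (ln (real n)))\<^sup>2" using l by (intro power_strict_mono) auto
      then have "8 * l\<^sup>2 \<le> ln (real n) / 2" using n by (simp add: power_mult_distrib)
      then have "exp (- (ln (real n) / 2)) \<le> exp (- 8 * l\<^sup>2)" by simp
      moreover have "exp (- (ln (real n) / 2)) = 1 / sqrt (real n)"
        using n by (simp add: exp_minus ln_sqrt[symmetric] inverse_eq_divide)
      ultimately have \<delta>: "1 / sqrt (real n) / 4 \<le> exp (- 8 * l\<^sup>2) / 4" by simp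
      have "exp (- 8 * l\<^sup>2) \<le> 1" by simp
      then have nonneg: "0 \<le> 1 - exp (- 8 * l\<^sup>2) / 4" by linarith
      have "1 - exp (- 8 * l\<^sup>2) / 4 \<le> 1 + - (1 / sqrt (real n) / 4)" using \<delta> by simp
      also have "\<dots> \<le> exp (- (1 / sqrt (real n) / 4))" by (rule exp_ge_add_one_self)
      finally have "(1 - exp (- 8 * l\<^sup>2) / 4) ^ k \<le> exp (- (1 / sqrt (real n) / 4)) ^ k"
        by (rule power_mono[OF _ nonneg])
      also have "\<dots> = exp (- (real k / sqrt (real n) / 4))"
        by (simp add: exp_of_nat_mult[symmetric])
      also have "\<dots> \<le> exp (- sqrt (real n) / 8)"
      proof -
        have "sqrt (real n) = real n / sqrt (real n)" using n by (simp add: real_div_sqrt)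
        also have "\<dots> \<le> 2 * real k / sqrt (real n)" using k by (intro divide_right_mono) auto
        finally show ?thesis by simp
      qed
      finally have "5 / 2 * real n * (1 - exp (- 8 * l\<^sup>2) / 4) ^ k \<le> 5 / 2 * real n * exp (- sqrt (real n) / 8)"
        by (intro mult_left_mono) auto
      moreover have "5 / 2 * real n * exp (- sqrt (real n) / 8) < 49 / 50" using n by (intro N) simp
      ultimately show False using * by linarith
    qed
  qed simp
qed

theorem lemma4p6:
  shows "\<exists>c::real. c > 0 \<and>
    (\<forall>n::nat. n \<ge> 2 \<longrightarrow> d_PC n (cube n) (unit_ball n) \<ge> c * sqrt (ln (real n)))"
proof -
  obtain N :: nat where N: "N \<ge> 2" "\<And>n l k. n \<ge> N \<Longrightarrow> 0 \<le> l \<Longrightarrow> n \<le> 2 * k \<Longrightarrow>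
     49 / 50 \<le> 5 / 2 * real n * (1 - exp (- 8 * l\<^sup>2) / 4) ^ k \<Longrightarrow> sqrt (ln (real n)) / 4 \<le> l"
    using sqrt_ln_le_of_large_dimension by metis
  \<comment> \<open>The value 1/4 serves dimensions from \<open>N\<close> on. The second value
    ensures \<open>c * sqrt (ln n) <= 1\<close> for \<open>n < N\<close>, where
    \<open>l >= 1\<close> already suffices.\<close>
  define c where "c = min (1 / 4) (1 / sqrt (ln (real N)))"
  have lnN: "ln (real N) > 0" using N(1) by simp
  have "d_PC n (cube n) (unit_ball n) \<ge> c * sqrt (ln (real n))" if n: "n \<ge> 2" for n
    unfolding d_PC_def
  proof (rule cInf_greatest)
    \<comment> \<open>Nonemptiness is witnessed by the identity matrix and zero translations, at the
      level \<open>n^2\<close>.\<close>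
    have zero: "translate_set (0\<^sub>v n) A = A" if "A \<subseteq> carrier_vec n" for A
      using that by (force simp: translate_set_def image_def)
    have one: "linear_image (1\<^sub>m n) A = A" if "A \<subseteq> carrier_vec n" for A
      using that by (force simp: linear_image_def image_def)
    have "invertible_mat (1\<^sub>m n :: real mat)"
      unfolding invertible_mat_def inverts_mat_def by (intro conjI exI[of _ "1\<^sub>m n"]) auto
    then show "{l. l \<ge> 1 \<and> (\<exists>T \<in> carrier_mat n n. \<exists>x \<in> carrier_vec n. \<exists>y \<in> carrier_vec n.
        invertible_mat T \<and>
        (let K2' = translate_set y (unit_ball n); K1' = linear_image T (translate_set x (cube n))
         in partially_contained n l K1' K2' \<and> partially_contained n l K2' K1'))} \<noteq> {}"
      using n cube_ball_admissible[of n]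
      by (auto simp: Let_def zero one subset_carrier_vec
          intro!: exI[of _ "(real n)\<^sup>2"] bexI[of _ "1\<^sub>m n :: real mat"] bexI[of _ "0\<^sub>v n :: rvec"])
    fix l assume "l \<in> {l. l \<ge> 1 \<and> (\<exists>T \<in> carrier_mat n n. \<exists>x \<in> carrier_vec n. \<exists>y \<in> carrier_vec n.
        invertible_mat T \<and>
        (let K2' = translate_set y (unit_ball n); K1' = linear_image T (translate_set x (cube n))
         in partially_contained n l K1' K2' \<and> partially_contained n l K2' K1'))}"
    then obtain T x y where l: "l \<ge> 1" and T: "T \<in> carrier_mat n n" "invertible_mat T"
      and xy: "x \<in> carrier_vec n" "y \<in> carrier_vec n"
      and pc: "partially_contained n l (linear_image T (translate_set x (cube n))) (translate_set y (unit_ball n))"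
      "partially_contained n l (translate_set y (unit_ball n)) (linear_image T (translate_set x (cube n)))"
      by (auto simp: Let_def)
    show "c * sqrt (ln (real n)) \<le> l"
    proof (cases "n \<ge> N")
      case True
      obtain k where "n \<le> 2 * k" "49 / 50 \<le> 5 / 2 * real n * (1 - exp (- 8 * l\<^sup>2) / 4) ^ k"
        using partially_contained_cube_ball_bound[OF _ l T xy pc] n by auto
      then have "sqrt (ln (real n)) / 4 \<le> l" using True l by (intro N(2)) auto
      moreover have "c * sqrt (ln (real n)) \<le> 1 / 4 * sqrt (ln (real n))"
        using n by (intro mult_right_mono) (auto simp: c_def)
      ultimately show ?thesis by simp
    next
      case False
      have "c * sqrt (ln (real n)) \<le> 1 / sqrt (ln (real N)) * sqrt (ln (real N))"
        using n False lnN by (intro mult_mono) (auto simp: c_def)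
      also have "\<dots> = 1" using lnN by simp
      finally show ?thesis using l by simp
    qed
  qed
  moreover have "c > 0" using lnN by (simp add: c_def)
  ultimately show ?thesis by blast
qed

end
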